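(* Let $G$ be a simply connected nilpotent Lie group with Lie algebra $\mathfrak g$, let $\Gamma$ be a lattice in $G$, and let $T=(T_\gamma)_{\gamma\in\Gamma}$ be a measure preserving action of $\Gamma$ on a $\sigma$-finite standard measure space $(X,\mathfrak B,\mu)$. Then the subsets $\mathcal R(T)$ and $\mathcal Ri(T)$ are both $G_\delta$ in $P(\mathfrak g)$.
   Context: $P(\mathfrak g)$ is the set of lines (1-dimensional linear subspaces) in $\mathfrak g$ with the usual topology of projective space. For $\theta\in P(\mathfrak g)$, $\exp(\theta)=\{\exp(v): v\in\theta\}$ is the corresponding closed one-parameter subgroup of $G$. A right-invariant metric $\mathrm{dist}$ on $G$ compatible with the topology is fixed. $T$ is recurrent along $\theta\in P(\mathfrak g)$ if for each $\epsilon>0$ and every $A\in\mathfrak B$ with $\mu(A)>0$ there are $\gamma\in\Gamma\setminus\{1_\Gamma\}$ and $g\in\exp(\theta)$ such that $\mathrm{dist}(\gamma,g)<\epsilon$ and $\mu(A\cap T_\gamma A)>0$. $\mathcal R(T)$ is the set of all $\theta\in P(\mathfrak g)$ such that $T$ is recurrent along $\theta$. $T$ is rigid along $\theta\in P(\mathfrak g)$ if there is a sequence $(\gamma_n)_{n\ge1}$ in $\Gamma$ with $\gamma_n\to\infty$ such that $\lim_{n\to\infty}\inf_{g\in\exp(\theta)}\mathrm{dist}(\gamma_n,g)=0$ and $\lim_{n\to\infty}\mu(A\cap T_{\gamma_n}A)=\mu(A)$ for each $A\in\mathfrak B$ with $\mu(A)<\infty$. $\mathcal Ri(T)$ is the set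 of all $\theta\in P(\mathfrak g)$ such that $T$ is rigid along $\theta$. *)

theory Defs
  imports "HOL-Analysis.Analysis"
begin

text \<open>
  Groups are written additively although they need not be commutative: the class
  \<^class>\<open>topological_group_add\<close> does not include commutativity. So \<open>0\<close> is the identity, \<open>x + y\<close>
  the product and \<open>- x\<close> the inverse.
\<close>

section \<open>Nilpotent groups\<close>

definition add_subgroup :: "'g::group_add set \<Rightarrow> bool" where
  "add_subgroup H \<longleftrightarrow> 0 \<in> H \<and> (\<forall>x\<in>H. \<forall>y\<in>H. x + y \<in> H) \<and> (\<forall>x\<in>H. - x \<in> H)"

definition generated_subgroup :: "'g::group_add set \<Rightarrow> 'g set" where
  "generated_subgroup S = \<Inter> {H. add_subgroup H \<and> S \<subseteq> H}"

text \<open>The term \<open>x + y - x - y\<close> is the commutator, i.e. \<open>((x + y) + (- x)) + (- y)\<close>.\<close>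

primrec lower_central_series :: "nat \<Rightarrow> 'g::group_add set" where
  "lower_central_series 0 = UNIV"
| "lower_central_series (Suc n) =
     generated_subgroup {x + y - x - y | x y. y \<in> lower_central_series n}"

definition nilpotent_group :: "'g::group_add itself \<Rightarrow> bool" where
  "nilpotent_group _ \<longleftrightarrow> (\<exists>n. lower_central_series n = {0::'g})"

section \<open>Lie groups\<close>

text \<open>For open \<open>S\<close>, \<open>k_smooth_on k S f\<close> says that \<open>f\<close> is of class \<open>C\<^sup>k\<close> on \<open>S\<close>.\<close>

primrec k_smooth_on ::
    "nat \<Rightarrow> 'a::real_normed_vector set \<Rightarrow> ('a \<Rightarrow> 'b::real_normed_vector) \<Rightarrow> bool" where
  "k_smooth_on 0 S f \<longleftrightarrow> continuous_on S f"
| "k_smooth_on (Suc k) S f \<longleftrightarrow>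
     (\<forall>x\<in>S. f differentiable (at x)) \<and>
     (\<forall>v. k_smooth_on k S (\<lambda>x. frechet_derivative f (at x) v))"

definition smooth_on ::
    "'a::real_normed_vector set \<Rightarrow> ('a \<Rightarrow> 'b::real_normed_vector) \<Rightarrow> bool" where
  "smooth_on S f \<longleftrightarrow> (\<forall>k. k_smooth_on k S f)"

text \<open>A chart is a pair of a domain and a map, of which only the values on the domain matter.\<close>

type_synonym ('m, 'e) chart = "'m set \<times> ('m \<Rightarrow> 'e)"

definition is_chart :: "('m::topological_space, 'e::euclidean_space) chart \<Rightarrow> bool" where
  "is_chart = (\<lambda>(U, \<phi>). open U \<and> open (\<phi> ` U) \<and> homeomorphism U (\<phi> ` U) \<phi> (inv_into U \<phi>))"

definition smooth_atlas :: "('m::topological_space, 'e::euclidean_space) chart set \<Rightarrow> bool" where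
  "smooth_atlas \<A> \<longleftrightarrow>
     (\<forall>\<kappa>\<in>\<A>. is_chart \<kappa>) \<and> (\<Union>(U, \<phi>)\<in>\<A>. U) = UNIV \<and>
     (\<forall>(U, \<phi>)\<in>\<A>. \<forall>(V, \<psi>)\<in>\<A>. smooth_on (\<phi> ` (U \<inter> V)) (\<psi> \<circ> inv_into U \<phi>))"

definition product_atlas ::
    "('m, 'e) chart set \<Rightarrow> ('n, 'f) chart set \<Rightarrow> ('m \<times> 'n, 'e \<times> 'f) chart set" where
  "product_atlas \<A> \<B> = {(U \<times> V, map_prod \<phi> \<psi>) | U \<phi> V \<psi>. (U, \<phi>) \<in> \<A> \<and> (V, \<psi>) \<in> \<B>}"

definition smooth_map ::
    "('m::topological_space, 'e::euclidean_space) chart set \<Rightarrow>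
     ('n::topological_space, 'f::euclidean_space) chart set \<Rightarrow> ('m \<Rightarrow> 'n) \<Rightarrow> bool" where
  "smooth_map \<A> \<B> f \<longleftrightarrow>
     continuous_on UNIV f \<and>
     (\<forall>(U, \<phi>)\<in>\<A>. \<forall>(V, \<psi>)\<in>\<B>. smooth_on (\<phi> ` (U \<inter> f -` V)) (\<psi> \<circ> f \<circ> inv_into U \<phi>))"

text \<open>The Hausdorff and second countability axioms for manifolds are left to the type class of
  \<^typ>\<open>'g\<close>.\<close>

definition lie_group :: "('g::topological_group_add, 'e::euclidean_space) chart set \<Rightarrow> bool" where
  "lie_group \<A> \<longleftrightarrow>
     smooth_atlas \<A> \<and>
     smooth_map (product_atlas \<A> \<A>) \<A> (\<lambda>(x, y). x + y) \<and>
     smooth_map \<A> \<A> uminus"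

section \<open>Exponential map and the projective space of the Lie algebra\<close>

text \<open>
  A chart \<open>\<phi>\<close> around the identity identifies the Lie algebra (the tangent space at the identity)
  with \<^typ>\<open>'e\<close>: the vector \<open>v\<close> stands for the class of the curves \<open>c\<close> with \<open>c 0 = 0\<close> and
  \<open>(\<phi> \<circ> c)'(0) = v\<close>. Changing the chart changes this identification by a linear isomorphism.
\<close>

definition one_parameter_subgroup :: "(real \<Rightarrow> 'g::topological_group_add) \<Rightarrow> bool" where
  "one_parameter_subgroup c \<longleftrightarrow> continuous_on UNIV c \<and> (\<forall>s t. c (s + t) = c s + c t)"

definition lie_exp ::
    "('g::topological_group_add \<Rightarrow> 'e::euclidean_space) \<Rightarrow> 'e \<Rightarrow> 'g" where
  "lie_exp \<phi> v =
     (THE c. one_parameter_subgroup c \<and> ((\<phi> \<circ> c) has_vector_derivative v) (at 0)) 1"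

definition lines :: "'e::euclidean_space set set" where
  "lines = {L. subspace L \<and> dim L = 1}"

text \<open>The quotient topology under \<open>v \<mapsto> span {v}\<close>, \<open>v \<noteq> 0\<close>.\<close>

definition projective_space :: "'e::euclidean_space set topology" where
  "projective_space = topology (\<lambda>V. V \<subseteq> lines \<and> open {v. v \<noteq> 0 \<and> span {v} \<in> V})"

lemma openin_projective_space:
  fixes V :: "'e::euclidean_space set set"
  shows "openin projective_space V \<longleftrightarrow> V \<subseteq> lines \<and> open {v. v \<noteq> 0 \<and> span {v} \<in> V}"
proof -
  have "istopology (\<lambda>V::'e set set. V \<subseteq> lines \<and> open {v. v \<noteq> 0 \<and> span {v} \<in> V})"
    unfolding istopology_def
  proof (intro conjI allI impI)
    fix S T :: "'e set set"
    assume S: "S \<subseteq> lines \<and> open {v. v \<noteq> 0 \<and> span {v} \<in> S}"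
      and T: "T \<subseteq> lines \<and> open {v. v \<noteq> 0 \<and> span {v} \<in> T}"
    show "S \<inter> T \<subseteq> lines" using S by blast
    have "{v. v \<noteq> 0 \<and> span {v} \<in> S \<inter> T} =
        {v. v \<noteq> 0 \<and> span {v} \<in> S} \<inter> {v. v \<noteq> 0 \<and> span {v} \<in> T}" by blast
    then show "open {v. v \<noteq> 0 \<and> span {v} \<in> S \<inter> T}" using S T by auto
  next
    fix K :: "'e set set set"
    assume K: "\<forall>V\<in>K. V \<subseteq> lines \<and> open {v. v \<noteq> 0 \<and> span {v} \<in> V}"
    show "\<Union> K \<subseteq> lines" using K by blast
    have "{v. v \<noteq> 0 \<and> span {v} \<in> \<Union> K} = (\<Union>V\<in>K. {v. v \<noteq> 0 \<and> span {v} \<in> V})" by blast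
    then show "open {v. v \<noteq> 0 \<and> span {v} \<in> \<Union> K}" using K by auto
  qed
  then show ?thesis
    unfolding projective_space_def by (simp add: topology_inverse')
qed

lemma topspace_projective_space: "topspace projective_space = (lines :: 'e::euclidean_space set set)"
proof -
  have "{v::'e. v \<noteq> 0 \<and> span {v} \<in> lines} = - {0}"
    by (auto simp: lines_def dim_span dim_singleton)
  then have "openin projective_space (lines :: 'e set set)"
    by (simp add: openin_projective_space open_Compl)
  then show ?thesis
    by (metis openin_projective_space openin_subset openin_topspace subset_antisym)
qed

section \<open>Lattices\<close>

definition left_cosets :: "'g::group_add set \<Rightarrow> 'g set set" where
  "left_cosets \<Gamma> = {(+) g ` \<Gamma> | g. True}"

text \<open>
  The coset space carries the quotient topology, in which a set \<open>W\<close> of cosets is open iff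
  \<open>\<Union> W\<close> is open in the group. A lattice is a discrete subgroup whose coset space has a nonzero
  finite Borel measure invariant under the group.
\<close>

definition lattice_subgroup :: "'g::topological_group_add set \<Rightarrow> bool" where
  "lattice_subgroup \<Gamma> \<longleftrightarrow>
     add_subgroup \<Gamma> \<and> discrete \<Gamma> \<and>
     (\<exists>\<nu> :: 'g set measure.
        space \<nu> = left_cosets \<Gamma> \<and>
        sets \<nu> = sigma_sets (left_cosets \<Gamma>) {W. W \<subseteq> left_cosets \<Gamma> \<and> open (\<Union> W)} \<and>
        (\<forall>g. \<forall>B\<in>sets \<nu>. emeasure \<nu> ((\<lambda>C. (+) g ` C) ` B) = emeasure \<nu> B) \<and>
        0 < emeasure \<nu> (space \<nu>) \<and> emeasure \<nu> (space \<nu>) < \<infinity>)"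

section \<open>Measure preserving actions\<close>

definition standard_measure_space :: "'x measure \<Rightarrow> bool" where
  "standard_measure_space M \<longleftrightarrow>
     (\<exists>X. topspace X = space M \<and> completely_metrizable_space X \<and> second_countable X \<and>
          sets M = sigma_sets (space M) {U. openin X U})"

definition measure_preserving_action ::
    "'g::group_add set \<Rightarrow> 'x measure \<Rightarrow> ('g \<Rightarrow> 'x \<Rightarrow> 'x) \<Rightarrow> bool" where
  "measure_preserving_action \<Gamma> M T \<longleftrightarrow>
     (\<forall>x\<in>space M. T 0 x = x) \<and>
     (\<forall>\<gamma>\<in>\<Gamma>. \<forall>\<delta>\<in>\<Gamma>. \<forall>x\<in>space M. T (\<gamma> + \<delta>) x = T \<gamma> (T \<delta> x)) \<and>
     (\<forall>\<gamma>\<in>\<Gamma>. T \<gamma> \<in> measurable M M \<and>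
        (\<forall>A\<in>sets M. emeasure M (T \<gamma> -` A \<inter> space M) = emeasure M A))"

text \<open>In the following, \<open>\<phi>\<close> is a chart around the identity, used to identify lines in the Lie
  algebra with lines in \<^typ>\<open>'e\<close>.\<close>

definition recurrent_along ::
    "('g::{metric_space, topological_group_add} \<Rightarrow> 'e::euclidean_space) \<Rightarrow>
     'g set \<Rightarrow> 'x measure \<Rightarrow> ('g \<Rightarrow> 'x \<Rightarrow> 'x) \<Rightarrow> 'e set \<Rightarrow> bool" where
  "recurrent_along \<phi> \<Gamma> M T \<theta> \<longleftrightarrow>
     (\<forall>\<epsilon>>0. \<forall>A\<in>sets M. emeasure M A > 0 \<longrightarrow>
        (\<exists>\<gamma>\<in>\<Gamma> - {0}. \<exists>g\<in>lie_exp \<phi> ` \<theta>.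
           dist \<gamma> g < \<epsilon> \<and> emeasure M (A \<inter> T \<gamma> ` A) > 0))"

definition recurrent_directions ::
    "('g::{metric_space, topological_group_add} \<Rightarrow> 'e::euclidean_space) \<Rightarrow>
     'g set \<Rightarrow> 'x measure \<Rightarrow> ('g \<Rightarrow> 'x \<Rightarrow> 'x) \<Rightarrow> 'e set set" where
  "recurrent_directions \<phi> \<Gamma> M T = {\<theta> \<in> lines. recurrent_along \<phi> \<Gamma> M T \<theta>}"

text \<open>In the discrete group \<open>\<Gamma>\<close>, \<open>\<gamma>\<^sub>n \<longlongrightarrow> \<infinity>\<close> means that \<open>\<gamma>\<^sub>n\<close> leaves every finite set.\<close>

definition rigid_along ::
    "('g::{metric_space, topological_group_add} \<Rightarrow> 'e::euclidean_space) \<Rightarrow>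
     'g set \<Rightarrow> 'x measure \<Rightarrow> ('g \<Rightarrow> 'x \<Rightarrow> 'x) \<Rightarrow> 'e set \<Rightarrow> bool" where
  "rigid_along \<phi> \<Gamma> M T \<theta> \<longleftrightarrow>
     (\<exists>\<gamma> :: nat \<Rightarrow> 'g. (\<forall>n. \<gamma> n \<in> \<Gamma>) \<and> filterlim \<gamma> cofinite sequentially \<and>
        (\<lambda>n. INF g\<in>lie_exp \<phi> ` \<theta>. dist (\<gamma> n) g) \<longlonglongrightarrow> 0 \<and>
        (\<forall>A\<in>sets M. emeasure M A < \<infinity> \<longrightarrow>
           (\<lambda>n. emeasure M (A \<inter> T (\<gamma> n) ` A)) \<longlonglongrightarrow> emeasure M A))"

definition rigid_directions ::
    "('g::{metric_space, topological_group_add} \<Rightarrow> 'e::euclidean_space) \<Rightarrow>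
     'g set \<Rightarrow> 'x measure \<Rightarrow> ('g \<Rightarrow> 'x \<Rightarrow> 'x) \<Rightarrow> 'e set set" where
  "rigid_directions \<phi> \<Gamma> M T = {\<theta> \<in> lines. rigid_along \<phi> \<Gamma> M T \<theta>}"

end

theory Submission
  imports Defs
begin

text \<open>
  Both sets are countable intersections of unions of finite intersections of sets of lines \<open>\<theta>\<close> for
  which \<open>exp \<theta>\<close> meets a given ball. Such a set is open because the exponential map is continuous.

  Continuity of the exponential map: in a chart around the identity with \<open>m\<close> the group operation, a
  second order Taylor bound gives
  \<open>\<bar>m(x, y) - m(x', y) - m(x, y') + m(x', y')\<bar> \<le> K \<bar>x - x'\<bar> \<bar>y - y'\<bar>\<close>. Consequently the \<open>n\<close>-th
  multiple is Lipschitz with constant \<open>2 n\<close> on a ball of radius \<open>\<delta> / n\<close>, so that the \<open>n\<close>-th multiples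
  of \<open>v / n\<close> converge to a limit which is Lipschitz in \<open>v\<close>. The limit is additive on lines.

  Rigidity may be tested on a countable dense family of sets of finite measure. Recurrence may not be
  tested there directly, as \<open>\<mu>(A \<inter> T\<^sub>\<gamma> A) > 0\<close> is not stable under approximation of \<open>A\<close>. Instead,
  recurrence along a set \<open>S\<close> of group elements yields, for each \<open>A\<close> of positive finite measure, a
  partial injection of \<open>A\<close> into itself which moves points by finitely many elements of \<open>S\<close> and whose
  domain has measure more than \<open>\<mu>(A) / 3\<close>. That property is stable, and back from it one gets
  recurrence.
\<close>

section \<open>Multiples and one-parameter subgroups\<close>

text \<open>\<open>lie_exp\<close> is a definite description, so its continuity presupposes that
  exactly one one-parameter subgroup has a given velocity. Both halves come from estimates for
  products in a single chart, without flows of invariant vector fields: the limit of multiples gives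
  existence, and the linear growth of the Lipschitz constant of \<open>nmul\<close> gives
  uniqueness.

  The G-delta claims depend on where \<theta> enters. The quantifiers over all measurable sets and
  over sequences are replaced by a conjunction indexed by natural numbers or pairs of them. Each
  conjunct asserts the existence of group elements, for recurrence together with sets of the measure
  space, and \<theta> constrains only the group elements, through the strict inequality in
  \<open>near\<close>. This is why a matching has finitely many pieces: only finite intersections of
  open sets need be open. The fraction 1/3 comes from truncation: an infinite greedy injection
  covers at least half of the set, and every fraction below one half is exceeded by a finite part of
  it.\<close>

primrec nmul :: "nat \<Rightarrow> 'a::monoid_add \<Rightarrow> 'a" where
  "nmul 0 g = 0"
| "nmul (Suc n) g = nmul n g + g"

lemma nmul_zero [simp]: "nmul n 0 = 0"
  by (induction n) auto

lemma nmul_add: "nmul (m + n) g = nmul m g + nmul n g"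
  by (induction n) (auto simp: add.assoc)

lemma nmul_mult: "nmul (m * n) g = nmul m (nmul n g)"
  by (induction m) (auto simp: nmul_add add.commute[of n])

lemma nmul_comm:
  assumes "a + b = b + (a::'a::monoid_add)"
  shows "nmul n a + b = b + nmul n a"
proof (induction n)
  case (Suc n)
  have "nmul (Suc n) a + b = nmul n a + b + a" using assms by (simp add: add.assoc)
  also have "\<dots> = b + nmul (Suc n) a" by (simp add: Suc add.assoc)
  finally show ?case .
qed simp

lemma nmul_add_comm:
  assumes "a + b = b + (a::'a::monoid_add)"
  shows "nmul n (a + b) = nmul n a + nmul n b"
proof (induction n)
  case (Suc n)
  have "nmul n b + a = a + nmul n b" by (rule nmul_comm) (simp add: assms)
  then have "nmul n a + (nmul n b + a) = nmul n a + (a + nmul n b)" by simp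
  then show ?case using Suc by (simp add: add.assoc[symmetric])
qed simp

lemma nmul_uminus: "nmul n (- g) = - nmul n (g::'a::group_add)"
proof (induction n)
  case (Suc n)
  have "nmul n g + g = g + nmul n g" by (rule nmul_comm) simp
  then show ?case using Suc by (metis minus_add nmul.simps(2))
qed simp

lemma tendsto_nmul [tendsto_intros]:
  fixes f :: "'a \<Rightarrow> 'b::topological_monoid_add"
  assumes "(f \<longlongrightarrow> a) F"
  shows "((\<lambda>x. nmul n (f x)) \<longlongrightarrow> nmul n a) F"
  by (induction n) (auto intro!: tendsto_intros assms)

lemma continuous_on_nmul [continuous_intros]:
  fixes f :: "'a::topological_space \<Rightarrow> 'b::topological_monoid_add"
  assumes "continuous_on S f"
  shows "continuous_on S (\<lambda>x. nmul n (f x))"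
  by (induction n) (auto intro!: continuous_intros assms)

lemma one_parameter_subgroup_zero:
  assumes "one_parameter_subgroup c"
  shows "c 0 = 0"
proof -
  have "c (0 + 0) = c 0 + c 0" using assms unfolding one_parameter_subgroup_def by blast
  then have "c 0 + c 0 = c 0 + 0" by simp
  then show ?thesis by (simp only: add_left_cancel)
qed

lemma one_parameter_subgroup_nmul:
  assumes "one_parameter_subgroup c"
  shows "c (real n * t) = nmul n (c t)"
proof (induction n)
  case 0
  show ?case using one_parameter_subgroup_zero[OF assms] by simp
next
  case (Suc n)
  have "c (real (Suc n) * t) = c (real n * t + t)" by (simp add: algebra_simps)
  then show ?case using Suc assms by (simp add: one_parameter_subgroup_def)
qed

section \<open>The exponential map of a local group\<close>

text \<open>
  The assumption \<open>mixed\<close> is all that is used of the smoothness of the group operation. With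
  \<open>a' = b' = 0\<close> it says that addition in the group is addition in the chart up to
  \<open>K * norm (\<psi> a) * norm (\<psi> b)\<close>.
\<close>

locale local_group_chart =
  fixes U :: "'g::{t2_space, topological_group_add} set"
    and \<psi> :: "'g \<Rightarrow> 'e::euclidean_space"
    and \<sigma> :: "'e \<Rightarrow> 'g"
    and r K \<delta> :: real
  assumes open_U: "open U" and zero_U: "0 \<in> U" and psi_zero: "\<psi> 0 = 0"
    and cont_psi: "continuous_on U \<psi>"
    and cont_sigma: "continuous_on (cball 0 r) \<sigma>"
    and sigma_psi: "g \<in> U \<Longrightarrow> \<sigma> (\<psi> g) = g"
    and sigma_U: "norm x \<le> r \<Longrightarrow> \<sigma> x \<in> U" and psi_sigma: "norm x \<le> r \<Longrightarrow> \<psi> (\<sigma> x) = x"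
    and add_U: "\<lbrakk>a \<in> U; b \<in> U; norm (\<psi> a) \<le> r; norm (\<psi> b) \<le> r\<rbrakk> \<Longrightarrow> a + b \<in> U"
    and mixed: "\<lbrakk>a \<in> U; a' \<in> U; b \<in> U; b' \<in> U;
        norm (\<psi> a) \<le> r; norm (\<psi> a') \<le> r; norm (\<psi> b) \<le> r; norm (\<psi> b') \<le> r\<rbrakk> \<Longrightarrow>
        norm (\<psi> (a + b) - \<psi> (a' + b) - \<psi> (a + b') + \<psi> (a' + b'))
          \<le> K * norm (\<psi> a - \<psi> a') * norm (\<psi> b - \<psi> b')"
    and minus_U: "\<lbrakk>g \<in> U; norm (\<psi> g) \<le> \<delta>\<rbrakk> \<Longrightarrow> - g \<in> U \<and> norm (\<psi> (- g)) \<le> r"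
    and K_nonneg: "0 \<le> K" and \<delta>_pos: "0 < \<delta>" and \<delta>_r: "4 * \<delta> \<le> r" and \<delta>_K: "8 * K * \<delta> \<le> 1"
begin

section \<open>Sums and multiples in chart coordinates\<close>

lemma r_pos: "0 < r"
  using \<delta>_pos \<delta>_r by linarith

lemma sigma_zero [simp]: "\<sigma> 0 = 0"
  using sigma_psi[OF zero_U] psi_zero by simp

text \<open>The form in which the choice \<open>\<delta>_K\<close> is used: multiples are taken only
  while \<open>k * norm (\<psi> g)\<close> stays below \<open>2 * \<delta>\<close>, so that an error
  factor is at most 1/4.\<close>

lemma K_le: "t \<le> 2 * \<delta> \<Longrightarrow> K * t \<le> 1 / 4"
  using mult_left_mono[of t "2 * \<delta>" K] K_nonneg \<delta>_K by linarith

lemma add_estimate: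
  assumes "a \<in> U" "b \<in> U" "norm (\<psi> a) \<le> r" "norm (\<psi> b) \<le> r"
  shows "norm (\<psi> (a + b) - \<psi> a - \<psi> b) \<le> K * norm (\<psi> a) * norm (\<psi> b)"
  using mixed[of a 0 b 0] assms zero_U psi_zero r_pos by (simp add: algebra_simps)

text \<open>The case \<open>b' = 0\<close> of \<open>mixed\<close>: translation by \<open>b\<close>
  differs from the identity by a map with Lipschitz constant \<open>K * norm (\<psi> b)\<close>. A
  constant tending to 1 with \<open>b\<close> is what keeps long iterations under control.\<close>

lemma left_lipschitz:
  assumes "a \<in> U" "a' \<in> U" "b \<in> U" "norm (\<psi> a) \<le> r" "norm (\<psi> a') \<le> r" "norm (\<psi> b) \<le> r"
  shows "norm (\<psi> (a + b) - \<psi> (a' + b)) \<le> (1 + K * norm (\<psi> b)) * norm (\<psi> a - \<psi> a')"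
proof -
  have "norm (\<psi> (a + b) - \<psi> (a' + b) - (\<psi> a - \<psi> a')) \<le> K * norm (\<psi> a - \<psi> a') * norm (\<psi> b)"
    using mixed[of a a' b 0] assms zero_U psi_zero r_pos by (simp add: algebra_simps)
  moreover have "norm (\<psi> (a + b) - \<psi> (a' + b))
      \<le> norm (\<psi> (a + b) - \<psi> (a' + b) - (\<psi> a - \<psi> a')) + norm (\<psi> a - \<psi> a')"
    by (metis diff_add_cancel norm_triangle_ineq)
  ultimately show ?thesis by (simp add: algebra_simps)
qed

lemma right_lipschitz:
  assumes "a \<in> U" "b' \<in> U" "b \<in> U" "norm (\<psi> a) \<le> r" "norm (\<psi> b') \<le> r" "norm (\<psi> b) \<le> r"
  shows "norm (\<psi> (a + b) - \<psi> (a + b')) \<le> (1 + K * norm (\<psi> a)) * norm (\<psi> b - \<psi> b')"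
proof -
  have "norm (\<psi> (a + b) - \<psi> (a + b') - (\<psi> b - \<psi> b')) \<le> K * norm (\<psi> a) * norm (\<psi> b - \<psi> b')"
    using mixed[of a 0 b b'] assms zero_U psi_zero r_pos by (simp add: algebra_simps)
  moreover have "norm (\<psi> (a + b) - \<psi> (a + b'))
      \<le> norm (\<psi> (a + b) - \<psi> (a + b') - (\<psi> b - \<psi> b')) + norm (\<psi> b - \<psi> b')"
    by (metis diff_add_cancel norm_triangle_ineq)
  ultimately show ?thesis by (simp add: algebra_simps)
qed

text \<open>With \<open>s = norm (\<psi> g)\<close>, the step from \<open>k\<close> to
  \<open>k + 1\<close> adds an error of at most \<open>2 * K * k * s\<^sup>2\<close>, and
  \<open>k\<^sup>2 + 2 * k \<le> (k + 1)\<^sup>2\<close>. The factor 2 in the last bound keeps the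
  multiple within \<open>4 * \<delta> \<le> r\<close>, where the next step is allowed. The range
  \<open>2 * \<delta>\<close> instead of \<delta> leaves room for elements such as
  \<open>nmul k (\<sigma> w)\<close> and \<open>- \<sigma> x\<close>, whose size is itself known
  only up to a factor 2.\<close>

lemma nmul_estimate:
  assumes g: "g \<in> U"
  shows "real k * norm (\<psi> g) \<le> 2 * \<delta> \<Longrightarrow>
    nmul k g \<in> U \<and> norm (\<psi> (nmul k g) - real k *\<^sub>R \<psi> g) \<le> K * (real k * norm (\<psi> g))\<^sup>2 \<and>
    norm (\<psi> (nmul k g)) \<le> 2 * (real k * norm (\<psi> g))"
proof (induction k)
  case 0
  then show ?case by (simp add: zero_U psi_zero)
next
  case (Suc k)
  define s where "s = norm (\<psi> g)"
  have s0: "0 \<le> s" by (simp add: s_def)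
  have ks: "(1 + real k) * s \<le> 2 * \<delta>" using Suc.prems by (simp add: s_def)
  have "0 \<le> real k * s" using s0 by simp
  then have "real k * s \<le> 2 * \<delta>" "s \<le> 2 * \<delta>"
    using ks s0 unfolding distrib_right by linarith+
  then have IH: "nmul k g \<in> U" "norm (\<psi> (nmul k g) - real k *\<^sub>R \<psi> g) \<le> K * (real k * s)\<^sup>2"
      "norm (\<psi> (nmul k g)) \<le> 2 * (real k * s)"
    using Suc.IH by (auto simp: s_def)
  have r: "norm (\<psi> (nmul k g)) \<le> r" "norm (\<psi> g) \<le> r"
    using IH(3) \<open>real k * s \<le> 2 * \<delta>\<close> \<open>s \<le> 2 * \<delta>\<close> \<delta>_r \<delta>_pos by (auto simp: s_def)
  have U': "nmul (Suc k) g \<in> U" using add_U[OF IH(1) g r] by simp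
  have "norm (\<psi> (nmul (Suc k) g) - \<psi> (nmul k g) - \<psi> g) \<le> K * norm (\<psi> (nmul k g)) * s"
    using add_estimate[OF IH(1) g r] by (simp add: s_def)
  also have "\<dots> \<le> K * (2 * (real k * s)) * s"
    using IH(3) K_nonneg s0 by (intro mult_right_mono mult_left_mono) auto
  finally have 1: "norm (\<psi> (nmul (Suc k) g) - \<psi> (nmul k g) - \<psi> g) \<le> K * (2 * (real k * s)) * s" .
  have "\<psi> (nmul (Suc k) g) - real (Suc k) *\<^sub>R \<psi> g =
      (\<psi> (nmul (Suc k) g) - \<psi> (nmul k g) - \<psi> g) + (\<psi> (nmul k g) - real k *\<^sub>R \<psi> g)"
    by (simp add: algebra_simps)
  then have "norm (\<psi> (nmul (Suc k) g) - real (Suc k) *\<^sub>R \<psi> g)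
      \<le> K * (2 * (real k * s)) * s + K * (real k * s)\<^sup>2"
    using 1 IH(2) norm_triangle_le by (metis add_mono)
  also have "\<dots> = K * ((real k * s)\<^sup>2 + 2 * real k * s\<^sup>2)"
    by (simp add: algebra_simps power2_eq_square)
  also have "\<dots> \<le> K * (real (Suc k) * s)\<^sup>2"
    using K_nonneg by (intro mult_left_mono) (auto simp: algebra_simps power2_eq_square)
  finally have 2: "norm (\<psi> (nmul (Suc k) g) - real (Suc k) *\<^sub>R \<psi> g) \<le> K * (real (Suc k) * s)\<^sup>2" .
  have "K * (real (Suc k) * s) \<le> 1" using K_le[of "real (Suc k) * s"] ks by auto
  then have "K * (real (Suc k) * s) * (real (Suc k) * s) \<le> 1 * (real (Suc k) * s)"
    using s0 by (intro mult_right_mono) auto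
  then have 3: "K * (real (Suc k) * s)\<^sup>2 \<le> real (Suc k) * s"
    by (simp add: power2_eq_square mult.assoc)
  have "norm (\<psi> (nmul (Suc k) g))
      \<le> norm (\<psi> (nmul (Suc k) g) - real (Suc k) *\<^sub>R \<psi> g) + norm (real (Suc k) *\<^sub>R \<psi> g)"
    by (metis diff_add_cancel norm_triangle_ineq)
  also have "norm (real (Suc k) *\<^sub>R \<psi> g) = real (Suc k) * s" by (simp add: s_def)
  finally have "norm (\<psi> (nmul (Suc k) g)) \<le> 2 * (real (Suc k) * s)" using 2 3 by linarith
  then show ?case using U' 2 by (simp add: s_def)
qed

text \<open>One further summand is exchanged in two moves through \<open>nmul k h + g\<close>. With
  \<open>d = norm (\<psi> g - \<psi> h)\<close>, translation of the earlier difference costs an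
  extra \<open>d / 2\<close>, and replacing the last summand costs \<open>3 / 2 * d\<close>;
  together they raise the constant by exactly 2.\<close>

lemma nmul_lipschitz:
  assumes g: "g \<in> U" and h: "h \<in> U"
  shows "\<lbrakk>real k * norm (\<psi> g) \<le> 2 * \<delta>; real k * norm (\<psi> h) \<le> 2 * \<delta>\<rbrakk> \<Longrightarrow>
    norm (\<psi> (nmul k g) - \<psi> (nmul k h)) \<le> 2 * real k * norm (\<psi> g - \<psi> h)"
proof (induction k)
  case (Suc k)
  define d where "d = norm (\<psi> g - \<psi> h)"
  have d0: "0 \<le> d" by (simp add: d_def)
  have mono: "real k * norm (\<psi> x) \<le> 2 * \<delta> \<and> norm (\<psi> x) \<le> 2 * \<delta>"
    if "real (Suc k) * norm (\<psi> x) \<le> 2 * \<delta>" for x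
  proof -
    have "0 \<le> real k * norm (\<psi> x)" by simp
    moreover have "real k * norm (\<psi> x) + norm (\<psi> x) \<le> 2 * \<delta>" using that by (simp add: algebra_simps)
    ultimately show ?thesis using norm_ge_zero[of "\<psi> x"] by linarith
  qed
  note mg = mono[OF Suc.prems(1)] and mh = mono[OF Suc.prems(2)]
  have eg: "nmul k g \<in> U" "norm (\<psi> (nmul k g)) \<le> 2 * (real k * norm (\<psi> g))"
    and eh: "nmul k h \<in> U" "norm (\<psi> (nmul k h)) \<le> 2 * (real k * norm (\<psi> h))"
    using nmul_estimate[OF g] nmul_estimate[OF h] mg mh by auto
  have r: "norm (\<psi> (nmul k g)) \<le> r" "norm (\<psi> (nmul k h)) \<le> r" "norm (\<psi> g) \<le> r" "norm (\<psi> h) \<le> r"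
    using eg eh mg mh \<delta>_r \<delta>_pos by auto
  have IH: "norm (\<psi> (nmul k g) - \<psi> (nmul k h)) \<le> 2 * real k * d"
    using Suc.IH mg mh by (simp add: d_def)
  have "norm (\<psi> (nmul k g + g) - \<psi> (nmul k h + g))
      \<le> (1 + K * norm (\<psi> g)) * norm (\<psi> (nmul k g) - \<psi> (nmul k h))"
    by (rule left_lipschitz) (use eg eh g r in auto)
  also have "\<dots> \<le> (1 + K * norm (\<psi> g)) * (2 * real k * d)"
    using IH K_nonneg by (intro mult_left_mono) auto
  also have "\<dots> = 2 * real k * d + 2 * d * (K * (real k * norm (\<psi> g)))"
    by (simp add: algebra_simps)
  also have "\<dots> \<le> 2 * real k * d + 2 * d * (1 / 4)"
    using K_le[of "real k * norm (\<psi> g)"] mg d0 by (intro add_left_mono mult_left_mono) auto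
  finally have 1: "norm (\<psi> (nmul k g + g) - \<psi> (nmul k h + g)) \<le> 2 * real k * d + d / 2" by simp
  have "norm (\<psi> (nmul k h + g) - \<psi> (nmul k h + h)) \<le> (1 + K * norm (\<psi> (nmul k h))) * d"
    unfolding d_def by (rule right_lipschitz) (use eg eh g h r in auto)
  also have "\<dots> \<le> (1 + 1 / 2) * d"
  proof -
    have "K * norm (\<psi> (nmul k h)) \<le> K * (2 * (real k * norm (\<psi> h)))"
      using eh(2) K_nonneg by (intro mult_left_mono) auto
    also have "\<dots> \<le> 1 / 2" using K_le[of "real k * norm (\<psi> h)"] mh by auto
    finally show ?thesis using d0 by (intro mult_right_mono) auto
  qed
  finally have 2: "norm (\<psi> (nmul k h + g) - \<psi> (nmul k h + h)) \<le> 3 / 2 * d" by simp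
  have "norm (\<psi> (nmul (Suc k) g) - \<psi> (nmul (Suc k) h))
      \<le> norm (\<psi> (nmul k g + g) - \<psi> (nmul k h + g)) + norm (\<psi> (nmul k h + g) - \<psi> (nmul k h + h))"
    unfolding nmul.simps by (metis dist_norm dist_triangle)
  then have "norm (\<psi> (nmul (Suc k) g) - \<psi> (nmul (Suc k) h)) \<le> 2 * real (Suc k) * d"
    using 1 2 by (simp add: algebra_simps)
  then show ?case by (simp add: d_def)
qed simp

lemma nmul_sigma_estimate:
  assumes w: "real n * norm w \<le> \<delta>" and n: "n \<noteq> 0"
  shows "nmul n (\<sigma> w) \<in> U" "norm (\<psi> (nmul n (\<sigma> w)) - real n *\<^sub>R w) \<le> K * (real n * norm w)\<^sup>2"
    "norm (\<psi> (nmul n (\<sigma> w))) \<le> 2 * (real n * norm w)"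
proof -
  have "1 * norm w \<le> real n * norm w" using n by (intro mult_right_mono) auto
  then have "norm w \<le> r" using w \<delta>_r \<delta>_pos by simp
  then have "\<sigma> w \<in> U" "\<psi> (\<sigma> w) = w" using sigma_U psi_sigma by auto
  then show "nmul n (\<sigma> w) \<in> U" "norm (\<psi> (nmul n (\<sigma> w)) - real n *\<^sub>R w) \<le> K * (real n * norm w)\<^sup>2"
    "norm (\<psi> (nmul n (\<sigma> w))) \<le> 2 * (real n * norm w)"
    using nmul_estimate[of "\<sigma> w" n] w \<delta>_pos by auto
qed

lemma nmul_sigma_lipschitz:
  assumes "real n * norm v \<le> \<delta>" "real n * norm w \<le> \<delta>" and n: "n \<noteq> 0"
  shows "norm (\<psi> (nmul n (\<sigma> v)) - \<psi> (nmul n (\<sigma> w))) \<le> 2 * real n * norm (v - w)"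
proof -
  have "norm x \<le> r" if "real n * norm x \<le> \<delta>" for x :: 'e
  proof -
    have "1 * norm x \<le> real n * norm x" using n by (intro mult_right_mono) auto
    then show ?thesis using that \<delta>_r \<delta>_pos by simp
  qed
  then have *: "\<sigma> v \<in> U" "\<psi> (\<sigma> v) = v" "\<sigma> w \<in> U" "\<psi> (\<sigma> w) = w" using assms sigma_U psi_sigma by auto
  show ?thesis using nmul_lipschitz[OF *(1,3), of n] assms * \<delta>_pos by simp
qed

text \<open>In the chart \<open>nmul k (\<sigma> w)\<close> and
  \<open>\<sigma> (real k *\<^sub>R w)\<close> differ only to second order, and the outer
  \<open>n\<close>-th multiple magnifies this by at most \<open>2 * n\<close>.\<close>

lemma nmul_mult_sigma:
  assumes w: "real (n * k) * norm w \<le> \<delta>" and n: "n \<noteq> 0" and k: "k \<noteq> 0"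
  shows "norm (\<psi> (nmul (n * k) (\<sigma> w)) - \<psi> (nmul n (\<sigma> (real k *\<^sub>R w))))
    \<le> 2 * real n * (K * (real k * norm w)\<^sup>2)"
proof -
  have "1 * (real k * norm w) \<le> real n * (real k * norm w)" using n by (intro mult_right_mono) auto
  then have kw: "real k * norm w \<le> \<delta>" using w by (simp add: mult.assoc)
  note e = nmul_sigma_estimate[OF kw k]
  have "norm (real k *\<^sub>R w) \<le> r" using kw \<delta>_r \<delta>_pos by simp
  then have s: "\<sigma> (real k *\<^sub>R w) \<in> U" "\<psi> (\<sigma> (real k *\<^sub>R w)) = real k *\<^sub>R w"
    using sigma_U psi_sigma by blast+
  have "real n * norm (\<psi> (nmul k (\<sigma> w))) \<le> real n * (2 * (real k * norm w))"
    using e(3) by (intro mult_left_mono) auto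
  then have "real n * norm (\<psi> (nmul k (\<sigma> w))) \<le> 2 * \<delta>" using w by simp
  then have "norm (\<psi> (nmul n (nmul k (\<sigma> w))) - \<psi> (nmul n (\<sigma> (real k *\<^sub>R w))))
      \<le> 2 * real n * norm (\<psi> (nmul k (\<sigma> w)) - real k *\<^sub>R w)"
    using nmul_lipschitz[OF e(1) s(1), of n] w s(2) \<delta>_pos by simp
  also have "\<dots> \<le> 2 * real n * (K * (real k * norm w)\<^sup>2)"
    using e(2) by (intro mult_left_mono) auto
  finally show ?thesis by (simp add: nmul_mult)
qed

section \<open>Euler approximations and the local exponential map\<close>

definition euler :: "nat \<Rightarrow> 'e \<Rightarrow> 'e" where
  "euler n v = \<psi> (nmul n (\<sigma> ((1 / real n) *\<^sub>R v)))"

text \<open>The exponential map in the chart.\<close>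

definition log_exp :: "'e \<Rightarrow> 'e" where
  "log_exp v = lim (\<lambda>n. euler n v)"

definition local_exp :: "'e \<Rightarrow> 'g" where
  "local_exp v = \<sigma> (log_exp v)"

text \<open>This is \<open>nmul_mult_sigma\<close> for \<open>w = v / (n * m)\<close>. The bound
  does not depend on \<open>m\<close>, so passing to an arbitrary refinement costs only
  O(1/n).\<close>

lemma euler_refine:
  assumes v: "norm v \<le> \<delta>" and n: "n \<noteq> 0" and m: "m \<noteq> 0"
  shows "norm (euler (n * m) v - euler n v) \<le> 2 * K * (norm v)\<^sup>2 / real n"
proof -
  have "norm (\<psi> (nmul (n * m) (\<sigma> ((1 / real (n * m)) *\<^sub>R v))) - \<psi> (nmul n (\<sigma> (real m *\<^sub>R (1 / real (n * m)) *\<^sub>R v))))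
     \<le> 2 * real n * (K * (real m * norm ((1 / real (n * m)) *\<^sub>R v))\<^sup>2)"
    by (rule nmul_mult_sigma) (use assms in auto)
  also have "\<dots> = 2 * K * (norm v)\<^sup>2 / real n"
    using n m by (simp add: field_simps power2_eq_square)
  finally show ?thesis using n m by (simp add: euler_def)
qed

lemma euler_bounds:
  assumes v: "norm v \<le> \<delta>" and n: "n \<noteq> 0"
  shows "norm (euler n v - v) \<le> K * (norm v)\<^sup>2" "norm (euler n v) \<le> 2 * norm v"
  using nmul_sigma_estimate[of n "(1 / real n) *\<^sub>R v"] assms by (simp_all add: euler_def)

lemma euler_lipschitz:
  assumes "norm v \<le> \<delta>" "norm w \<le> \<delta>" and n: "n \<noteq> 0"
  shows "norm (euler n v - euler n w) \<le> 2 * norm (v - w)"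
  using nmul_sigma_lipschitz[of n "(1 / real n) *\<^sub>R v" "(1 / real n) *\<^sub>R w"] assms
  by (simp add: euler_def flip: scaleR_diff_right)

lemma euler_LIMSEQ:
  assumes v: "norm v \<le> \<delta>"
  shows "(\<lambda>n. euler n v) \<longlonglongrightarrow> log_exp v"
proof -
  have "Cauchy (\<lambda>n. euler n v)"
  proof (rule CauchyI)
    fix e :: real assume e: "0 < e"
    define C where "C = 2 * K * (norm v)\<^sup>2"
    have C0: "0 \<le> C" using K_nonneg by (simp add: C_def)
    obtain N where N: "N > 0" "2 * C / e < real N"
      using reals_Archimedean2[of "2 * C / e"] C0 e
      by (metis divide_nonneg_pos gr0I mult_nonneg_nonneg not_less of_nat_0 zero_le_numeral)
    show "\<exists>M. \<forall>m\<ge>M. \<forall>n\<ge>M. norm (euler m v - euler n v) < e"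
    proof (intro exI allI impI)
      fix m n assume mn: "N \<le> m" "N \<le> n"
      have b: "norm (euler (i * j) v - euler i v) < e / 2" if "N \<le> i" "N \<le> j" for i j
      proof -
        have "norm (euler (i * j) v - euler i v) \<le> C / real i"
          unfolding C_def by (rule euler_refine) (use that N v in auto)
        also have "\<dots> \<le> C / real N" using that N C0 by (intro divide_left_mono) auto
        also have "\<dots> < e / 2" using N e by (simp add: field_simps)
        finally show ?thesis .
      qed
      \<comment> \<open>Both approximations are compared with their common refinement
        \<open>m * n\<close>.\<close>
      have "norm (euler m v - euler n v) \<le> norm (euler (m * n) v - euler m v) + norm (euler (n * m) v - euler n v)"
        by (metis dist_norm dist_triangle3 mult.commute norm_minus_commute)
      also have "\<dots> < e" using b[of m n] b[of n m] mn by simp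
      finally show "norm (euler m v - euler n v) < e" .
    qed
  qed
  then show ?thesis unfolding log_exp_def
    by (metis Cauchy_convergent convergent_LIMSEQ_iff)
qed

lemma log_exp_bounds:
  assumes v: "norm v \<le> \<delta>"
  shows "norm (log_exp v - v) \<le> K * (norm v)\<^sup>2" "norm (log_exp v) \<le> 2 * norm v"
  by (rule Lim_norm_ubound[OF _ tendsto_diff[OF euler_LIMSEQ[OF v] tendsto_const]]
      Lim_norm_ubound[OF _ euler_LIMSEQ[OF v]];
      use euler_bounds[OF v] in \<open>auto intro!: eventually_sequentiallyI[of 1]\<close>)+

lemma log_exp_lipschitz:
  assumes "norm v \<le> \<delta>" "norm w \<le> \<delta>"
  shows "norm (log_exp v - log_exp w) \<le> 2 * norm (v - w)"
  by (rule Lim_norm_ubound[OF _ tendsto_diff[OF euler_LIMSEQ euler_LIMSEQ]])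
    (use assms euler_lipschitz in \<open>auto intro!: eventually_sequentiallyI[of 1]\<close>)

lemma log_exp_r: "norm v \<le> \<delta> \<Longrightarrow> norm (log_exp v) \<le> r"
  using log_exp_bounds(2)[of v] \<delta>_r \<delta>_pos by linarith

lemma psi_local_exp: "norm v \<le> \<delta> \<Longrightarrow> \<psi> (local_exp v) = log_exp v"
  using log_exp_r sigma_U psi_sigma by (auto simp: local_exp_def)

lemma continuous_on_local_exp: "continuous_on (cball 0 \<delta>) local_exp"
proof -
  have "continuous_on (cball 0 \<delta>) log_exp"
    by (rule lipschitz_on_continuous_on[of 2], rule lipschitz_onI)
      (use log_exp_lipschitz in \<open>auto simp: dist_norm norm_minus_commute\<close>)
  then show ?thesis unfolding local_exp_def
    by (rule continuous_on_compose2[OF cont_sigma]) (auto simp: log_exp_r)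
qed

lemma tendsto_local_exp:
  assumes "f \<longlonglongrightarrow> v" "\<And>n. norm (f n) \<le> \<delta>" "norm v \<le> \<delta>"
  shows "(\<lambda>n. local_exp (f n)) \<longlonglongrightarrow> local_exp v"
  by (rule continuous_on_tendsto_compose[OF continuous_on_local_exp assms(1)]) (use assms in auto)

lemma tendsto_sigmaI:
  assumes "(\<lambda>n. \<psi> (f n)) \<longlonglongrightarrow> x" "\<forall>\<^sub>F n in sequentially. f n \<in> U" "norm x < r"
  shows "f \<longlonglongrightarrow> \<sigma> x"
proof -
  have "isCont \<sigma> x"
    using assms(3) continuous_on_subset[OF cont_sigma ball_subset_cball]
    by (intro continuous_on_interior[of "ball 0 r"]) auto
  then have "(\<lambda>n. \<sigma> (\<psi> (f n))) \<longlonglongrightarrow> \<sigma> x" using assms(1) by (rule isCont_tendsto_compose)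
  moreover have "\<forall>\<^sub>F n in sequentially. \<sigma> (\<psi> (f n)) = f n"
    using assms(2) by eventually_elim (simp add: sigma_psi)
  ultimately show ?thesis by (rule Lim_transform_eventually)
qed

lemma log_exp_less_r: "norm v \<le> \<delta> \<Longrightarrow> norm (log_exp v) < r"
  using log_exp_bounds(2)[of v] \<delta>_r \<delta>_pos by linarith

lemma local_exp_LIMSEQ:
  assumes v: "norm v \<le> \<delta>"
  shows "(\<lambda>n. nmul n (\<sigma> ((1 / real n) *\<^sub>R v))) \<longlonglongrightarrow> local_exp v"
  unfolding local_exp_def
proof (rule tendsto_sigmaI)
  show "(\<lambda>n. \<psi> (nmul n (\<sigma> ((1 / real n) *\<^sub>R v)))) \<longlonglongrightarrow> log_exp v"
    using euler_LIMSEQ[OF v] by (simp add: euler_def)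
  show "\<forall>\<^sub>F n in sequentially. nmul n (\<sigma> ((1 / real n) *\<^sub>R v)) \<in> U"
    using nmul_sigma_estimate(1) v by (auto intro!: eventually_sequentiallyI[of 1])
qed (use v log_exp_less_r in auto)

text \<open>Reduces each identity for \<open>local_exp\<close> to an O(1/n) comparison of
  approximants in the chart; limits in the group are unique because it is Hausdorff.\<close>

lemma local_exp_eqI:
  assumes v: "norm v \<le> \<delta>" and f: "f \<longlonglongrightarrow> g"
    and U: "\<forall>\<^sub>F n in sequentially. f n \<in> U"
    and b: "\<forall>\<^sub>F n in sequentially. norm (\<psi> (f n) - euler n v) \<le> C / real n"
  shows "local_exp v = g"
proof -
  have "(\<lambda>n. C / real n) \<longlonglongrightarrow> 0" by (rule lim_const_over_n)
  then have "(\<lambda>n. \<psi> (f n) - euler n v) \<longlonglongrightarrow> 0" using b by (rule Lim_null_comparison[rotated])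
  from tendsto_add[OF this euler_LIMSEQ[OF v]] have "(\<lambda>n. \<psi> (f n)) \<longlonglongrightarrow> log_exp v" by simp
  then have "f \<longlonglongrightarrow> local_exp v" unfolding local_exp_def
    by (rule tendsto_sigmaI) (use U v log_exp_less_r in auto)
  then show ?thesis using f LIMSEQ_unique by blast
qed

section \<open>Algebraic identities of the local exponential map\<close>

lemma local_exp_zero [simp]: "local_exp 0 = 0"
  by (rule local_exp_eqI[where f = "\<lambda>_. 0" and C = 0]) (use \<delta>_pos zero_U in \<open>auto simp: euler_def\<close>)

text \<open>Multiples of multiples commute, so the \<open>k\<close>-th multiple of the
  \<open>n\<close>-th approximant of \<open>w\<close> is the \<open>n\<close>-th multiple of
  \<open>nmul k (\<sigma> (w / n))\<close>; \<open>nmul_mult_sigma\<close> replaces the latter by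
  \<sigma> at \<open>k * w / n\<close> with total error O(1/n).\<close>

lemma local_exp_nmul:
  assumes w: "real k * norm w \<le> \<delta>"
  shows "local_exp (real k *\<^sub>R w) = nmul k (local_exp w)"
proof (cases "k = 0")
  case False
  have "1 * norm w \<le> real k * norm w" using False by (intro mult_right_mono) auto
  then have w1: "norm w \<le> \<delta>" using w by simp
  show ?thesis
  proof (rule local_exp_eqI)
    show "norm (real k *\<^sub>R w) \<le> \<delta>" using w by simp
    show "(\<lambda>n. nmul k (nmul n (\<sigma> ((1 / real n) *\<^sub>R w)))) \<longlonglongrightarrow> nmul k (local_exp w)"
      by (intro tendsto_nmul local_exp_LIMSEQ w1)
    have "nmul k (nmul n (\<sigma> ((1 / real n) *\<^sub>R w))) \<in> U \<and>
        norm (\<psi> (nmul k (nmul n (\<sigma> ((1 / real n) *\<^sub>R w)))) - euler n (real k *\<^sub>R w))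
          \<le> (2 * K * (real k * norm w)\<^sup>2) / real n" if n: "n \<ge> 1" for n
    proof
      have eq: "nmul k (nmul n (\<sigma> ((1 / real n) *\<^sub>R w))) = nmul (n * k) (\<sigma> ((1 / real n) *\<^sub>R w))"
        by (metis mult.commute nmul_mult)
      have b: "real (n * k) * norm ((1 / real n) *\<^sub>R w) \<le> \<delta>" using w n by simp
      show "nmul k (nmul n (\<sigma> ((1 / real n) *\<^sub>R w))) \<in> U" unfolding eq
        by (rule nmul_sigma_estimate(1)[OF b]) (use n False in auto)
      have "norm (\<psi> (nmul (n * k) (\<sigma> ((1 / real n) *\<^sub>R w))) - \<psi> (nmul n (\<sigma> (real k *\<^sub>R (1 / real n) *\<^sub>R w))))
        \<le> 2 * real n * (K * (real k * norm ((1 / real n) *\<^sub>R w))\<^sup>2)"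
        by (rule nmul_mult_sigma[OF b]) (use n False in auto)
      also have "\<dots> = (2 * K * (real k * norm w)\<^sup>2) / real n"
        using n by (simp add: field_simps power2_eq_square)
      finally show "norm (\<psi> (nmul k (nmul n (\<sigma> ((1 / real n) *\<^sub>R w)))) - euler n (real k *\<^sub>R w))
          \<le> (2 * K * (real k * norm w)\<^sup>2) / real n"
        unfolding eq by (simp add: euler_def mult.commute)
    qed
    then show "\<forall>\<^sub>F n in sequentially. nmul k (nmul n (\<sigma> ((1 / real n) *\<^sub>R w))) \<in> U"
      "\<forall>\<^sub>F n in sequentially. norm (\<psi> (nmul k (nmul n (\<sigma> ((1 / real n) *\<^sub>R w)))) - euler n (real k *\<^sub>R w))
          \<le> (2 * K * (real k * norm w)\<^sup>2) / real n"
      by (auto intro!: eventually_sequentiallyI[of 1])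
  qed
qed simp

text \<open>\<open>add_estimate\<close> for \<open>g + (- g) = 0\<close> bounds
  \<open>\<psi> (- g) + \<psi> g\<close> by
  \<open>K * norm (\<psi> g) * norm (\<psi> (- g))\<close>. Since \<open>K * norm (\<psi> g)\<close>
  is at most 1/4, the last factor can be absorbed, which gives the linear bound; inserting that
  bound again gives the quadratic one.\<close>

lemma psi_minus_estimate:
  assumes g: "g \<in> U" "norm (\<psi> g) \<le> \<delta>"
  shows "- g \<in> U" "norm (\<psi> (- g)) \<le> 2 * norm (\<psi> g)" "norm (\<psi> (- g) + \<psi> g) \<le> 2 * K * (norm (\<psi> g))\<^sup>2"
proof -
  have m: "- g \<in> U" "norm (\<psi> (- g)) \<le> r" using minus_U[OF g] by auto
  have "norm (\<psi> g) \<le> r" using g(2) \<delta>_r \<delta>_pos by linarith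
  note add_estimate[OF g(1) m(1) this m(2)]
  then have "norm (- \<psi> g - \<psi> (- g)) \<le> K * norm (\<psi> g) * norm (\<psi> (- g))"
    by (simp add: psi_zero)
  moreover have "- \<psi> g - \<psi> (- g) = - (\<psi> (- g) + \<psi> g)" by simp
  ultimately have "norm (- (\<psi> (- g) + \<psi> g)) \<le> K * norm (\<psi> g) * norm (\<psi> (- g))"
    by metis
  then have 1: "norm (\<psi> (- g) + \<psi> g) \<le> K * norm (\<psi> g) * norm (\<psi> (- g))"
    by (simp only: norm_minus_cancel)
  have "K * norm (\<psi> g) \<le> 1 / 4" using K_le[of "norm (\<psi> g)"] g(2) \<delta>_pos by linarith
  then have "K * norm (\<psi> g) * norm (\<psi> (- g)) \<le> 1 / 4 * norm (\<psi> (- g))"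
    by (intro mult_right_mono) auto
  moreover have "norm (\<psi> (- g)) \<le> norm (\<psi> (- g) + \<psi> g) + norm (\<psi> g)"
    using norm_triangle_ineq4[of "\<psi> (- g) + \<psi> g" "\<psi> g"] by simp
  ultimately have 2: "norm (\<psi> (- g)) \<le> 2 * norm (\<psi> g)" using 1 norm_ge_zero[of "\<psi> g"] by linarith
  have "K * norm (\<psi> g) * norm (\<psi> (- g)) \<le> K * norm (\<psi> g) * (2 * norm (\<psi> g))"
    using 2 K_nonneg by (intro mult_left_mono) auto
  then show "norm (\<psi> (- g) + \<psi> g) \<le> 2 * K * (norm (\<psi> g))\<^sup>2"
    using 1 by (simp add: power2_eq_square algebra_simps)
  show "- g \<in> U" "norm (\<psi> (- g)) \<le> 2 * norm (\<psi> g)" by fact+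
qed

text \<open>The negated approximant is the \<open>n\<close>-th multiple of
  \<open>- \<sigma> (w / n)\<close>, which differs from \<open>\<sigma> (- w / n)\<close> by
  O(1/n^2); taking the multiple leaves O(1/n).\<close>

lemma local_exp_minus:
  assumes w: "norm w \<le> \<delta>"
  shows "local_exp (- w) = - local_exp w"
proof (rule local_exp_eqI)
  show "norm (- w) \<le> \<delta>" using w by simp
  show "(\<lambda>n. - nmul n (\<sigma> ((1 / real n) *\<^sub>R w))) \<longlonglongrightarrow> - local_exp w"
    by (intro tendsto_minus local_exp_LIMSEQ w)
  have "- nmul n (\<sigma> ((1 / real n) *\<^sub>R w)) \<in> U \<and>
      norm (\<psi> (- nmul n (\<sigma> ((1 / real n) *\<^sub>R w))) - euler n (- w))
        \<le> (4 * K * (norm w)\<^sup>2) / real n" if n: "n \<ge> 1" for n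
  proof
    define x where "x = (1 / real n) *\<^sub>R w"
    have nx: "norm x = norm w / real n" by (simp add: x_def)
    have "norm w \<le> norm w * real n" using n mult_left_mono[of 1 "real n" "norm w"] by simp
    then have "norm x \<le> norm w" using n by (simp add: nx divide_le_eq)
    then have x: "norm x \<le> \<delta>" "norm x \<le> r" "norm (- x) \<le> r" using w \<delta>_r \<delta>_pos by auto
    have s: "\<sigma> x \<in> U" "\<psi> (\<sigma> x) = x" "\<sigma> (- x) \<in> U" "\<psi> (\<sigma> (- x)) = - x"
      using x sigma_U psi_sigma by blast+
    have e: "- \<sigma> x \<in> U" "norm (\<psi> (- \<sigma> x)) \<le> 2 * norm x" "norm (\<psi> (- \<sigma> x) + x) \<le> 2 * K * (norm x)\<^sup>2"
      using psi_minus_estimate[of "\<sigma> x"] s x by auto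
    have "real n * norm (\<psi> (- \<sigma> x)) \<le> real n * (2 * norm x)" using e(2) by (intro mult_left_mono) auto
    also have "\<dots> \<le> 2 * \<delta>" using w n by (simp add: nx)
    finally have f: "real n * norm (\<psi> (- \<sigma> x)) \<le> 2 * \<delta>" .
    then have "nmul n (- \<sigma> x) \<in> U" using nmul_estimate[OF e(1), of n] by blast
    then show "- nmul n (\<sigma> ((1 / real n) *\<^sub>R w)) \<in> U" by (simp add: nmul_uminus x_def)
    have "norm (\<psi> (nmul n (- \<sigma> x)) - \<psi> (nmul n (\<sigma> (- x)))) \<le> 2 * real n * norm (\<psi> (- \<sigma> x) - \<psi> (\<sigma> (- x)))"
      by (rule nmul_lipschitz) (use e s f w n \<delta>_pos in \<open>auto simp: nx\<close>)
    also have "\<dots> \<le> 2 * real n * (2 * K * (norm x)\<^sup>2)"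
      using e(3) s by (intro mult_left_mono) auto
    also have "\<dots> = (4 * K * (norm w)\<^sup>2) / real n"
      using n by (simp add: nx field_simps power2_eq_square)
    finally show "norm (\<psi> (- nmul n (\<sigma> ((1 / real n) *\<^sub>R w))) - euler n (- w)) \<le> (4 * K * (norm w)\<^sup>2) / real n"
      by (simp add: nmul_uminus x_def euler_def)
  qed
  then show "\<forall>\<^sub>F n in sequentially. - nmul n (\<sigma> ((1 / real n) *\<^sub>R w)) \<in> U"
    "\<forall>\<^sub>F n in sequentially. norm (\<psi> (- nmul n (\<sigma> ((1 / real n) *\<^sub>R w))) - euler n (- w))
        \<le> (4 * K * (norm w)\<^sup>2) / real n"
    by (auto intro!: eventually_sequentiallyI[of 1])
qed

text \<open>For rational \<open>s\<close> and \<open>t\<close> with a common denominator this is additivity of multiples, and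
  rounding \<open>s\<close> and \<open>t\<close> down to multiples of \<open>1 / n\<close> gives the general case in the limit.\<close>

lemma local_exp_add_nonneg:
  assumes st: "0 \<le> s" "0 \<le> t" "(s + t) * norm w \<le> \<delta>"
  shows "local_exp ((s + t) *\<^sub>R w) = local_exp (s *\<^sub>R w) + local_exp (t *\<^sub>R w)"
proof -
  define q where "q x n = real (nat \<lfloor>real n * x\<rfloor>) / real n" for x n
  have q_le: "q x n \<le> x" if "0 \<le> x" for x n
  proof (cases "n = 0")
    case False
    have "real (nat \<lfloor>real n * x\<rfloor>) \<le> real n * x" using that by simp
    then show ?thesis using False by (simp add: q_def divide_le_eq mult.commute)
  qed (use that in \<open>simp add: q_def\<close>)
  have q_lim: "q x \<longlonglongrightarrow> x" if "0 \<le> x" for x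
  proof (rule tendsto_sandwich)
    show "\<forall>\<^sub>F n in sequentially. x - 1 / real n \<le> q x n"
    proof (intro eventually_sequentiallyI[of 1])
      fix n :: nat assume "1 \<le> n"
      have "real n * x - 1 \<le> real (nat \<lfloor>real n * x\<rfloor>)" using that by simp
      then have "(real n * x - 1) / real n \<le> real (nat \<lfloor>real n * x\<rfloor>) / real n"
        by (rule divide_right_mono) simp
      then show "x - 1 / real n \<le> q x n" using \<open>1 \<le> n\<close> by (simp add: q_def diff_divide_distrib)
    qed
    show "\<forall>\<^sub>F n in sequentially. q x n \<le> x" using q_le[OF that] by simp
    show "(\<lambda>n. x - 1 / real n) \<longlonglongrightarrow> x"
      using tendsto_diff[OF tendsto_const lim_1_over_n, of x] by simp
  qed simp
  have q_nonneg: "0 \<le> q x n" for x n by (simp add: q_def)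
  have bound: "c * norm w \<le> \<delta>" if "c \<le> s + t" for c
    using st(3) mult_right_mono[OF that, of "norm w"] by simp
  have eq: "local_exp ((q s n + q t n) *\<^sub>R w) = local_exp (q s n *\<^sub>R w) + local_exp (q t n *\<^sub>R w)" for n
  proof (cases "n = 0")
    case False
    define j k where "j = nat \<lfloor>real n * s\<rfloor>" and "k = nat \<lfloor>real n * t\<rfloor>"
    have qj: "q s n = real j / real n" and qk: "q t n = real k / real n"
      by (simp_all add: q_def j_def k_def)
    have L: "local_exp ((real i / real n) *\<^sub>R w) = nmul i (local_exp ((1 / real n) *\<^sub>R w))"
      if "real i / real n \<le> s + t" for i
      using local_exp_nmul[of i "(1 / real n) *\<^sub>R w"] bound[OF that] by simp
    have "q s n + q t n = real (j + k) / real n" by (simp add: qj qk add_divide_distrib)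
    moreover have "real (j + k) / real n \<le> s + t" "real j / real n \<le> s + t" "real k / real n \<le> s + t"
      using q_le[of s n] q_le[of t n] st q_nonneg by (auto simp: add_divide_distrib qj qk)
    ultimately show ?thesis using L[of "j + k"] L[of j] L[of k] by (simp only: qj qk nmul_add)
  qed (simp add: q_def)
  have le: "q s n + q t n \<le> s + t" "q s n \<le> s + t" "q t n \<le> s + t" for n
    using q_le[of s n] q_le[of t n] st by linarith+
  have n1: "norm ((q s n + q t n) *\<^sub>R w) \<le> \<delta>" "norm (q s n *\<^sub>R w) \<le> \<delta>" "norm (q t n *\<^sub>R w) \<le> \<delta>" for n
    using bound[OF le(1)] bound[OF le(2)] bound[OF le(3)] q_nonneg[of s n] q_nonneg[of t n] by auto
  have n2: "norm ((s + t) *\<^sub>R w) \<le> \<delta>" "norm (s *\<^sub>R w) \<le> \<delta>" "norm (t *\<^sub>R w) \<le> \<delta>"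
    using bound[of "s + t"] bound[of s] bound[of t] st by auto
  have "(\<lambda>n. local_exp ((q s n + q t n) *\<^sub>R w)) \<longlonglongrightarrow> local_exp ((s + t) *\<^sub>R w)"
    by (intro tendsto_local_exp tendsto_intros q_lim n1 n2 st)
  moreover have "(\<lambda>n. local_exp (q s n *\<^sub>R w) + local_exp (q t n *\<^sub>R w))
      \<longlonglongrightarrow> local_exp (s *\<^sub>R w) + local_exp (t *\<^sub>R w)"
    by (intro tendsto_local_exp tendsto_intros q_lim n1 n2 st)
  ultimately show ?thesis unfolding eq by (rule LIMSEQ_unique)
qed

lemma local_exp_add:
  assumes "\<bar>s\<bar> * norm w \<le> \<delta>" "\<bar>t\<bar> * norm w \<le> \<delta>" "\<bar>s + t\<bar> * norm w \<le> \<delta>"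
  shows "local_exp ((s + t) *\<^sub>R w) = local_exp (s *\<^sub>R w) + local_exp (t *\<^sub>R w)"
proof -
  define h where "h x = local_exp (x *\<^sub>R w)" for x
  have neg: "h (- x) = - h x" if "\<bar>x\<bar> * norm w \<le> \<delta>" for x
    using local_exp_minus[of "x *\<^sub>R w"] that by (simp add: h_def)
  have nonneg: "h (x + y) = h x + h y" if "0 \<le> x" "0 \<le> y" "\<bar>x + y\<bar> * norm w \<le> \<delta>" for x y
    using local_exp_add_nonneg[of x y w] that by (simp add: h_def)
  have diff: "h (x + y) = h x + h y"
    if "0 \<le> x" "y < 0" "\<bar>x\<bar> * norm w \<le> \<delta>" "\<bar>y\<bar> * norm w \<le> \<delta>" "\<bar>x + y\<bar> * norm w \<le> \<delta>" for x y
  proof (cases "0 \<le> x + y")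
    case True
    have "h x = h (x + y) + h (- y)" using nonneg[of "x + y" "- y"] that True by simp
    then show ?thesis using neg[of y] that by simp
  next
    case False
    have "h (- y) = h (- (x + y)) + h x" using nonneg[of "- (x + y)" x] that False by simp
    then have "- h y = - h (x + y) + h x" using neg[of y] neg[of "x + y"] that by simp
    then have "h (x + y) + - h y + h y = h (x + y) + (- h (x + y) + h x) + h y" by (simp only:)
    then show ?thesis by (simp only: add_minus_cancel add.assoc left_minus add.right_neutral)
  qed
  have diff': "h (x + y) = h x + h y"
    if "x < 0" "0 \<le> y" "\<bar>x\<bar> * norm w \<le> \<delta>" "\<bar>y\<bar> * norm w \<le> \<delta>" "\<bar>x + y\<bar> * norm w \<le> \<delta>" for x y
  proof (cases "0 \<le> x + y")
    case True
    have "h y = h (- x) + h (x + y)" using nonneg[of "- x" "x + y"] that True by simp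
    then show ?thesis using neg[of x] that by (simp add: add.assoc[symmetric])
  next
    case False
    have "h (- x) = h y + h (- (x + y))" using nonneg[of y "- (x + y)"] that False by simp
    then have "- h x = h y + - h (x + y)" using neg[of x] neg[of "x + y"] that by simp
    then have "h x + - h x + h (x + y) = h x + (h y + - h (x + y)) + h (x + y)" by (simp only:)
    then show ?thesis by (simp only: add.assoc left_minus right_minus add.right_neutral add.left_neutral)
  qed
  have "h (s + t) = h s + h t"
  proof (cases "0 \<le> s"; cases "0 \<le> t")
    assume "\<not> 0 \<le> s" "\<not> 0 \<le> t"
    \<comment> \<open>The order is reversed because negation reverses sums in the group.\<close>
    then have "h (- t + - s) = h (- t) + h (- s)" using assms by (intro nonneg) (auto simp: algebra_simps)
    moreover have "- (s + t) = - t + - s" by simp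
    ultimately have "h (- (s + t)) = h (- t) + h (- s)" by metis
    then have "- h (s + t) = - h t + - h s" using neg[of s] neg[of t] neg[of "s + t"] assms by simp
    then have "- h (s + t) = - (h s + h t)" by (simp only: minus_add)
    then show ?thesis by (simp only: neg_equal_iff_equal)
  qed (use nonneg diff diff' assms in auto)
  then show ?thesis by (simp add: h_def)
qed

section \<open>Extension to the whole Lie algebra\<close>

definition global_exp :: "'e \<Rightarrow> 'g" where
  "global_exp v =
     (let n = Suc (nat \<lceil>norm v / \<delta>\<rceil>) in nmul n (local_exp ((1 / real n) *\<^sub>R v)))"

text \<open>The number of subdivisions in the definition is just one admissible choice, with
  \<open>Suc\<close> excluding 0. Any two choices \<open>n\<close> and \<open>m\<close> agree
  because both agree with \<open>n * m\<close>, by \<open>local_exp_nmul\<close>.\<close>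

lemma global_exp_eq:
  assumes n: "n \<noteq> 0" and v: "norm v \<le> real n * \<delta>"
  shows "global_exp v = nmul n (local_exp ((1 / real n) *\<^sub>R v))"
proof -
  define m where "m = Suc (nat \<lceil>norm v / \<delta>\<rceil>)"
  have m0: "m \<noteq> 0" by (simp add: m_def)
  have "norm v / \<delta> \<le> real m" unfolding m_def using \<delta>_pos by linarith
  then have m: "norm v \<le> real m * \<delta>" using \<delta>_pos by (simp add: divide_le_eq)
  have *: "nmul i (local_exp ((1 / real i) *\<^sub>R v)) = nmul (i * j) (local_exp ((1 / real (i * j)) *\<^sub>R v))"
    if "i \<noteq> 0" "j \<noteq> 0" "norm v \<le> real i * \<delta>" for i j
  proof -
    have "local_exp (real j *\<^sub>R (1 / real (i * j)) *\<^sub>R v) = nmul j (local_exp ((1 / real (i * j)) *\<^sub>R v))"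
      using that by (intro local_exp_nmul) (simp add: divide_le_eq mult.commute)
    then show ?thesis using that by (simp add: nmul_mult)
  qed
  show ?thesis
    using *[OF n m0 v] *[OF m0 n m] by (simp add: global_exp_def Let_def m_def[symmetric] mult.commute)
qed

text \<open>The number of subdivisions in the definition jumps as \<open>v\<close> varies, but on a
  ball around 0 containing \<open>v\<close> one fixed number serves all points, and there the map is
  a composition of continuous ones.\<close>

lemma continuous_on_global_exp: "continuous_on UNIV global_exp"
proof (rule continuous_at_imp_continuous_on, rule ballI)
  fix v :: 'e
  obtain n where "norm v / \<delta> < real n" using reals_Archimedean2 by blast
  then have n: "norm v < real n * \<delta>" using \<delta>_pos by (simp add: divide_less_eq)
  have n0: "n \<noteq> 0" using n by (metis mult_zero_left norm_ge_zero not_less of_nat_0)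
  have "continuous_on (ball 0 (real n * \<delta>)) (\<lambda>v. nmul n (local_exp ((1 / real n) *\<^sub>R v)))"
  proof (rule continuous_on_nmul, rule continuous_on_compose2[OF continuous_on_local_exp])
    show "continuous_on (ball 0 (real n * \<delta>)) (\<lambda>v::'e. (1 / real n) *\<^sub>R v)" by (intro continuous_intros)
    show "(\<lambda>v::'e. (1 / real n) *\<^sub>R v) ` ball 0 (real n * \<delta>) \<subseteq> cball 0 \<delta>"
    proof (rule image_subsetI)
      fix x :: 'e assume "x \<in> ball 0 (real n * \<delta>)"
      then show "(1 / real n) *\<^sub>R x \<in> cball 0 \<delta>" using n0 by (simp add: divide_le_eq mult.commute)
    qed
  qed
  then have "continuous_on (ball 0 (real n * \<delta>)) global_exp"
    by (subst continuous_on_cong[OF refl, where g = "\<lambda>v. nmul n (local_exp ((1 / real n) *\<^sub>R v))"])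
      (use global_exp_eq[OF n0] in auto)
  then show "isCont global_exp v"
    by (rule continuous_on_interior) (use n in auto)
qed

text \<open>One \<open>n\<close> serves \<open>s\<close>, \<open>t\<close> and \<open>s + t\<close>.
  The two local exponentials commute since \<open>s + t = t + s\<close>, hence the
  \<open>n\<close>-th multiple distributes over their sum.\<close>

lemma global_exp_add: "global_exp ((s + t) *\<^sub>R v) = global_exp (s *\<^sub>R v) + global_exp (t *\<^sub>R v)"
proof -
  define b where "b = (\<bar>s\<bar> + \<bar>t\<bar>) * norm v"
  obtain n where "b / \<delta> < real n" using reals_Archimedean2 by blast
  then have n: "b < real n * \<delta>" using \<delta>_pos by (simp add: divide_less_eq)
  have b0: "0 \<le> b" by (simp add: b_def)
  then have n0: "n \<noteq> 0" using n by (metis mult_zero_left not_less of_nat_0)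
  have le: "\<bar>x\<bar> * norm v \<le> real n * \<delta>" if "\<bar>x\<bar> \<le> \<bar>s\<bar> + \<bar>t\<bar>" for x
    using mult_right_mono[OF that, of "norm v"] n by (simp add: b_def)
  define w where "w = (1 / real n) *\<^sub>R v"
  have eq: "global_exp (x *\<^sub>R v) = nmul n (local_exp (x *\<^sub>R w))" if "\<bar>x\<bar> \<le> \<bar>s\<bar> + \<bar>t\<bar>" for x
    using global_exp_eq[OF n0, of "x *\<^sub>R v"] le[OF that] by (simp add: w_def mult.commute)
  have le': "\<bar>x\<bar> * norm w \<le> \<delta>" if "\<bar>x\<bar> \<le> \<bar>s\<bar> + \<bar>t\<bar>" for x
    using le[OF that] n0 by (simp add: w_def divide_le_eq mult.commute)
  have add: "local_exp ((x + y) *\<^sub>R w) = local_exp (x *\<^sub>R w) + local_exp (y *\<^sub>R w)"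
    if "x = s \<and> y = t \<or> x = t \<and> y = s" for x y
    by (rule local_exp_add) (use that in \<open>auto intro!: le'\<close>)
  have "local_exp (s *\<^sub>R w) + local_exp (t *\<^sub>R w) = local_exp (t *\<^sub>R w) + local_exp (s *\<^sub>R w)"
    using add[of s t] add[of t s] by (simp add: add.commute)
  from nmul_add_comm[OF this, of n] add[of s t] eq show ?thesis by simp
qed

lemma global_exp_subgroup: "one_parameter_subgroup (\<lambda>t. global_exp (t *\<^sub>R v))"
  unfolding one_parameter_subgroup_def
  by (auto simp: global_exp_add intro!: continuous_on_compose2[OF continuous_on_global_exp] continuous_intros)

lemma global_exp_derivative: "((\<psi> \<circ> (\<lambda>t. global_exp (t *\<^sub>R v))) has_vector_derivative v) (at 0)"
  unfolding has_vector_derivative_def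
proof (rule has_derivativeI)
  define f where "f = \<psi> \<circ> (\<lambda>t. global_exp (t *\<^sub>R v))"
  have f: "f t = log_exp (t *\<^sub>R v)" if "\<bar>t\<bar> * norm v \<le> \<delta>" for t
    using global_exp_eq[of 1 "t *\<^sub>R v"] psi_local_exp[of "t *\<^sub>R v"] that by (simp add: f_def)
  have f0: "f 0 = 0" using f[of 0] log_exp_bounds(2)[of 0] \<delta>_pos by simp
  have "\<forall>\<^sub>F t in at 0. norm (((f t - f 0) - t *\<^sub>R v) /\<^sub>R norm t) \<le> K * \<bar>t\<bar> * (norm v)\<^sup>2"
    unfolding eventually_at
  proof (intro exI conjI ballI impI)
    \<comment> \<open>The summand 1 covers the case \<open>v = 0\<close>.\<close>
    show "0 < \<delta> / (norm v + 1)" using \<delta>_pos by (simp add: add_nonneg_pos)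
    fix t :: real assume t: "t \<noteq> 0 \<and> dist t 0 < \<delta> / (norm v + 1)"
    then have "\<bar>t\<bar> * (norm v + 1) < \<delta>" by (simp add: less_divide_eq add_nonneg_pos)
    then have tv: "\<bar>t\<bar> * norm v \<le> \<delta>" by (simp add: algebra_simps)
    have "norm (f t - t *\<^sub>R v) \<le> K * (\<bar>t\<bar> * norm v)\<^sup>2"
      using log_exp_bounds(1)[of "t *\<^sub>R v"] tv f[OF tv] by simp
    then have "norm (f t - t *\<^sub>R v) / \<bar>t\<bar> \<le> K * (\<bar>t\<bar> * norm v)\<^sup>2 / \<bar>t\<bar>"
      by (intro divide_right_mono) auto
    also have "\<dots> = K * \<bar>t\<bar> * (norm v)\<^sup>2" using t by (simp add: power2_eq_square field_simps)
    finally show "norm (((f t - f 0) - t *\<^sub>R v) /\<^sub>R norm t) \<le> K * \<bar>t\<bar> * (norm v)\<^sup>2"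
      by (simp add: f0 divide_inverse mult.commute)
  qed
  moreover have "((\<lambda>t::real. K * \<bar>t\<bar> * (norm v)\<^sup>2) \<longlongrightarrow> 0) (at 0)"
    by (rule tendsto_eq_intros tendsto_rabs_zero refl | simp)+
  ultimately have "((\<lambda>t. ((f t - f 0) - t *\<^sub>R v) /\<^sub>R norm t) \<longlongrightarrow> 0) (at 0)"
    by (rule Lim_null_comparison)
  then show "((\<lambda>y. (f y - f 0 - (y - 0) *\<^sub>R v) /\<^sub>R norm (y - 0)) \<longlongrightarrow> 0) (at 0)" by simp
qed (rule bounded_linear_scaleR_left)

text \<open>Since \<open>c t = nmul n (c (t / n))\<close> and \<open>nmul n\<close> is Lipschitz with constant \<open>2 * n\<close>, two one-parameter
  subgroups whose difference is \<open>o(t)\<close> at \<open>0\<close> agree.\<close>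

lemma one_parameter_subgroup_unique:
  assumes c: "one_parameter_subgroup c" and d: "one_parameter_subgroup d"
    and c': "((\<psi> \<circ> c) has_vector_derivative v) (at 0)" and d': "((\<psi> \<circ> d) has_vector_derivative v) (at 0)"
  shows "c = d"
proof -
  have psi_bound: "\<exists>e>0. \<forall>t. \<bar>t\<bar> < e \<longrightarrow> f t \<in> U \<and> norm (\<psi> (f t) - t *\<^sub>R v) \<le> \<epsilon> * \<bar>t\<bar>"
    if f: "one_parameter_subgroup f" and f': "((\<psi> \<circ> f) has_vector_derivative v) (at 0)" and "\<epsilon> > 0" for f \<epsilon>
  proof -
    have f0: "f 0 = 0" using f by (rule one_parameter_subgroup_zero)
    have "isCont f 0" using f by (simp add: one_parameter_subgroup_def continuous_on_eq_continuous_at)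
    then have "\<forall>\<^sub>F t in nhds 0. f t \<in> U"
      using open_U zero_U f0 by (simp add: continuous_at_open eventually_nhds)
    then obtain e1 where e1: "e1 > 0" "\<And>t. \<bar>t\<bar> < e1 \<Longrightarrow> f t \<in> U"
      by (auto simp: eventually_nhds_metric)
    obtain e2 where e2: "e2 > 0" "\<And>t. \<bar>t\<bar> < e2 \<Longrightarrow> norm (\<psi> (f t) - t *\<^sub>R v) \<le> \<epsilon> * \<bar>t\<bar>"
      using f' \<open>\<epsilon> > 0\<close> unfolding has_vector_derivative_def has_derivative_at_alt
      by (auto simp: f0 psi_zero)
    show ?thesis by (rule exI[of _ "min e1 e2"]) (use e1 e2 in auto)
  qed
  obtain e1 where e1: "e1 > 0" "\<And>t. \<bar>t\<bar> < e1 \<Longrightarrow> c t \<in> U \<and> norm (\<psi> (c t) - t *\<^sub>R v) \<le> 1 * \<bar>t\<bar>"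
    using psi_bound[OF c c', of 1] by auto
  obtain e2 where e2: "e2 > 0" "\<And>t. \<bar>t\<bar> < e2 \<Longrightarrow> d t \<in> U \<and> norm (\<psi> (d t) - t *\<^sub>R v) \<le> 1 * \<bar>t\<bar>"
    using psi_bound[OF d d', of 1] by auto
  \<comment> \<open>The last term keeps \<open>\<bar>t\<bar> * (norm v + 1)\<close> below \<delta>.
    This quantity bounds the coordinates of \<open>c t\<close> and \<open>d t\<close>, and also
    \<open>n\<close> times those at \<open>t / n\<close>, as \<open>nmul_lipschitz\<close>
    requires.\<close>
  define e where "e = min (min e1 e2) (\<delta> / (norm v + 1))"
  have e0: "e > 0" using e1 e2 \<delta>_pos by (simp add: e_def add_nonneg_pos)
  have near: "c t \<in> U \<and> d t \<in> U \<and> norm (\<psi> (c t)) \<le> \<bar>t\<bar> * (norm v + 1) \<and> norm (\<psi> (d t)) \<le> \<bar>t\<bar> * (norm v + 1)"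
    if "\<bar>t\<bar> < e" for t
  proof -
    have "norm x \<le> \<bar>t\<bar> * (norm v + 1)" if "norm (x - t *\<^sub>R v) \<le> 1 * \<bar>t\<bar>" for x
      using that norm_triangle_ineq[of "x - t *\<^sub>R v" "t *\<^sub>R v"] by (simp add: algebra_simps)
    then show ?thesis using e1(2)[of t] e2(2)[of t] that by (auto simp: e_def)
  qed
  have local: "c t = d t" if t: "\<bar>t\<bar> < e" for t
  proof -
    have tb: "\<bar>t\<bar> * (norm v + 1) \<le> 2 * \<delta>"
      using t \<delta>_pos by (auto simp: e_def less_divide_eq add_nonneg_pos)
    have lim: "norm (\<psi> (c t) - \<psi> (d t)) \<le> \<eta>" if "\<eta> > 0" for \<eta>
    proof -
      \<comment> \<open>Two errors \<open>\<epsilon> * \<bar>t\<bar> / n\<close>, magnified by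
        \<open>2 * n\<close>, add up to \<open>4 * \<epsilon> * \<bar>t\<bar>\<close>, which must
        not exceed \<eta>.\<close>
      define \<epsilon> where "\<epsilon> = \<eta> / (4 * (\<bar>t\<bar> + 1))"
      have \<epsilon>: "\<epsilon> > 0" using that by (simp add: \<epsilon>_def)
      obtain a1 where a1: "a1 > 0" "\<And>t. \<bar>t\<bar> < a1 \<Longrightarrow> norm (\<psi> (c t) - t *\<^sub>R v) \<le> \<epsilon> * \<bar>t\<bar>"
        using psi_bound[OF c c' \<epsilon>] by blast
      obtain a2 where a2: "a2 > 0" "\<And>t. \<bar>t\<bar> < a2 \<Longrightarrow> norm (\<psi> (d t) - t *\<^sub>R v) \<le> \<epsilon> * \<bar>t\<bar>"
        using psi_bound[OF d d' \<epsilon>] by blast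
      define a where "a = min a1 (min a2 e)"
      have a0: "a > 0" using a1 a2 e0 by (simp add: a_def)
      obtain n where "\<bar>t\<bar> / a < real n" using reals_Archimedean2 by blast
      then have n: "\<bar>t\<bar> < real n * a" using a0 by (simp add: divide_less_eq)
      then have n0: "n \<noteq> 0" by (metis abs_ge_zero mult_zero_left not_less of_nat_0)
      define s where "s = t / real n"
      have s: "\<bar>s\<bar> < a" using n n0 by (simp add: s_def divide_less_eq mult.commute)
      have ns: "real n * s = t" "real n * \<bar>s\<bar> = \<bar>t\<bar>" using n0 by (simp_all add: s_def)
      have cd: "c t = nmul n (c s)" "d t = nmul n (d s)"
        using one_parameter_subgroup_nmul[OF c, of n s] one_parameter_subgroup_nmul[OF d, of n s] ns by auto
      have sb: "c s \<in> U" "d s \<in> U" "norm (\<psi> (c s)) \<le> \<bar>s\<bar> * (norm v + 1)" "norm (\<psi> (d s)) \<le> \<bar>s\<bar> * (norm v + 1)"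
        using near[of s] s by (auto simp: a_def)
      have nb: "real n * norm x \<le> 2 * \<delta>" if "norm x \<le> \<bar>s\<bar> * (norm v + 1)" for x :: 'e
      proof -
        have "real n * norm x \<le> real n * (\<bar>s\<bar> * (norm v + 1))" using that by (intro mult_left_mono) auto
        also have "\<dots> = \<bar>t\<bar> * (norm v + 1)" using ns by (simp add: mult.assoc[symmetric])
        finally show ?thesis using tb by simp
      qed
      have "norm (\<psi> (c t) - \<psi> (d t)) \<le> 2 * real n * norm (\<psi> (c s) - \<psi> (d s))"
        unfolding cd by (rule nmul_lipschitz) (use sb nb in auto)
      also have "\<dots> \<le> 2 * real n * (2 * \<epsilon> * \<bar>s\<bar>)"
      proof (intro mult_left_mono)
        have "norm (\<psi> (c s) - \<psi> (d s)) \<le> norm (\<psi> (c s) - s *\<^sub>R v) + norm (\<psi> (d s) - s *\<^sub>R v)"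
          by (metis dist_norm dist_triangle2)
        also have "\<dots> \<le> 2 * \<epsilon> * \<bar>s\<bar>" using a1(2)[of s] a2(2)[of s] s by (simp add: a_def)
        finally show "norm (\<psi> (c s) - \<psi> (d s)) \<le> 2 * \<epsilon> * \<bar>s\<bar>" .
      qed auto
      also have "\<dots> = 4 * \<epsilon> * \<bar>t\<bar>" using ns(2) by (simp add: algebra_simps)
      also have "\<dots> \<le> \<eta>" using that by (simp add: \<epsilon>_def divide_le_eq)
      finally show ?thesis .
    qed
    have "norm (\<psi> (c t) - \<psi> (d t)) \<le> 0" by (rule field_le_epsilon) (use lim in simp)
    then show ?thesis using near[OF t] sigma_psi by (metis norm_le_zero_iff right_minus_eq)
  qed
  show ?thesis
  proof
    fix t
    obtain n where "\<bar>t\<bar> / e < real n" using reals_Archimedean2 by blast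
    then have n: "\<bar>t\<bar> < real n * e" using e0 by (simp add: divide_less_eq)
    then have n0: "n \<noteq> 0" by (metis abs_ge_zero mult_zero_left not_less of_nat_0)
    have "c (t / real n) = d (t / real n)" using n n0 by (intro local) (simp add: divide_less_eq mult.commute)
    then show "c t = d t"
      using one_parameter_subgroup_nmul[OF c, of n "t / real n"]
        one_parameter_subgroup_nmul[OF d, of n "t / real n"] n0 by simp
  qed
qed

text \<open>The constant \<open>a\<close> undoes the normalisation \<open>psi_zero\<close>: a chart
  \<phi> equals its normalised version plus \<open>\<phi> 0\<close>, and additive constants do not
  affect velocities.\<close>

lemma lie_exp_eq_global_exp: "lie_exp (\<lambda>g. \<psi> g + a) = global_exp"
proof
  fix v
  have iff: "(((\<lambda>g. \<psi> g + a) \<circ> c) has_vector_derivative v) (at 0) \<longleftrightarrow>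
      ((\<psi> \<circ> c) has_vector_derivative v) (at 0)" for c :: "real \<Rightarrow> 'g"
    unfolding comp_def by (rule has_vector_derivative_add_const)
  have "(THE c. one_parameter_subgroup c \<and>
      (((\<lambda>g. \<psi> g + a) \<circ> c) has_vector_derivative v) (at 0)) = (\<lambda>t. global_exp (t *\<^sub>R v))"
    unfolding iff
    proof (rule the_equality)
    show "one_parameter_subgroup (\<lambda>t. global_exp (t *\<^sub>R v)) \<and>
        ((\<psi> \<circ> (\<lambda>t. global_exp (t *\<^sub>R v))) has_vector_derivative v) (at 0)"
      using global_exp_subgroup global_exp_derivative by simp
  next
    fix c assume "one_parameter_subgroup c \<and> ((\<psi> \<circ> c) has_vector_derivative v) (at 0)"
    then show "c = (\<lambda>t. global_exp (t *\<^sub>R v))"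
      using one_parameter_subgroup_unique[OF _ global_exp_subgroup _ global_exp_derivative] by simp
  qed
  then show "lie_exp (\<lambda>g. \<psi> g + a) v = global_exp v" by (simp add: lie_exp_def)
qed

end

section \<open>Continuity of the exponential map of a Lie group\<close>

text \<open>\<open>k_smooth_on\<close> gives continuity of the derivative only in each fixed
  direction. Compactness bounds it on every basis vector, summation bounds its operator norm, and
  convexity allows the mean value inequality.\<close>

lemma k_smooth_lipschitz_on_compact:
  fixes f :: "'a::euclidean_space \<Rightarrow> 'b::real_normed_vector"
  assumes f: "k_smooth_on (Suc 0) S f" and C: "compact C" "convex C" "C \<subseteq> S"
  obtains B where "0 \<le> B" "\<And>x y. \<lbrakk>x \<in> C; y \<in> C\<rbrakk> \<Longrightarrow> norm (f x - f y) \<le> B * norm (x - y)"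
proof -
  define f' where "f' x = frechet_derivative f (at x)" for x
  have der: "(f has_derivative f' x) (at x)" if "x \<in> C" for x
    using f that C(3) by (auto simp: f'_def frechet_derivative_works)
  have "\<exists>B. \<forall>x\<in>C. norm (f' x b) \<le> B" for b
  proof -
    have "continuous_on C (\<lambda>x. f' x b)" using f C(3) by (auto simp: f'_def intro: continuous_on_subset)
    from compact_imp_bounded[OF compact_continuous_image[OF this C(1)]] show ?thesis
      by (auto simp: bounded_iff)
  qed
  then obtain B where B: "norm (f' x b) \<le> B b" if "x \<in> C" for x b by metis
  \<comment> \<open>For empty \<open>C\<close> the function \<open>B\<close> is arbitrary; the
    absolute values keep \<open>B'\<close> nonnegative.\<close>
  define B' where "B' = (\<Sum>b\<in>Basis. \<bar>B b\<bar>)"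
  have on: "onorm (f' x) \<le> B'" if x: "x \<in> C" for x
  proof (rule onorm_le)
    fix v :: 'a
    have lin: "linear (f' x)" using der[OF x] has_derivative_linear by blast
    have "f' x v = f' x (\<Sum>b\<in>Basis. (v \<bullet> b) *\<^sub>R b)" by (simp add: euclidean_representation)
    also have "\<dots> = (\<Sum>b\<in>Basis. (v \<bullet> b) *\<^sub>R f' x b)"
      by (simp add: linear_sum[OF lin] linear_scale[OF lin])
    also have "norm \<dots> \<le> (\<Sum>b\<in>Basis. norm v * \<bar>B b\<bar>)"
    proof (rule sum_norm_le)
      fix b :: 'a assume "b \<in> Basis"
      then show "norm ((v \<bullet> b) *\<^sub>R f' x b) \<le> norm v * \<bar>B b\<bar>"
        using B[OF x, of b] by (auto intro!: mult_mono Basis_le_norm)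
    qed
    finally show "norm (f' x v) \<le> B' * norm v" by (simp add: B'_def sum_distrib_left mult.commute)
  qed
  show ?thesis
  proof (rule that)
    show "0 \<le> B'" by (simp add: B'_def sum_nonneg)
    fix x y assume "x \<in> C" "y \<in> C"
    then show "norm (f x - f y) \<le> B' * norm (x - y)"
      using differentiable_bound[OF C(2) has_derivative_at_withinI[OF der] on] by blast
  qed
qed

text \<open>The mean value inequality is used twice. In the first variable it is applied to
  \<open>m (x, y) - m (x, y')\<close>; the derivative of this difference is small because the
  partial derivatives of \<open>m\<close> are again Lipschitz, by the preceding lemma, one basis
  direction at a time.\<close>

lemma k_smooth_mixed_difference_bound:
  fixes m :: "'a::euclidean_space \<times> 'b::euclidean_space \<Rightarrow> 'c::real_normed_vector"
  assumes m: "k_smooth_on (Suc (Suc 0)) S m"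
    and C: "compact C" "convex C" and D: "compact D" "convex D" and CD: "C \<times> D \<subseteq> S"
  obtains K where "0 \<le> K" "\<And>x x' y y'. \<lbrakk>x \<in> C; x' \<in> C; y \<in> D; y' \<in> D\<rbrakk> \<Longrightarrow>
    norm (m (x, y) - m (x', y) - m (x, y') + m (x', y')) \<le> K * norm (x - x') * norm (y - y')"
proof -
  define m' where "m' p = frechet_derivative m (at p)" for p
  have der: "(m has_derivative m' p) (at p)" if "p \<in> C \<times> D" for p
    using m that CD by (auto simp: m'_def frechet_derivative_works)
  have "\<exists>L\<ge>0. \<forall>p\<in>C \<times> D. \<forall>q\<in>C \<times> D. norm (m' p (b, 0) - m' q (b, 0)) \<le> L * norm (p - q)" for b
  proof -
    have "k_smooth_on (Suc 0) S (\<lambda>p. m' p (b, 0))"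
      using m unfolding m'_def k_smooth_on.simps(2)[of "Suc 0"] by blast
    then obtain L where "0 \<le> L"
      "\<And>p q. \<lbrakk>p \<in> C \<times> D; q \<in> C \<times> D\<rbrakk> \<Longrightarrow> norm (m' p (b, 0) - m' q (b, 0)) \<le> L * norm (p - q)"
      by (rule k_smooth_lipschitz_on_compact[OF _ compact_Times[OF C(1) D(1)] convex_Times[OF C(2) D(2)] CD])
        blast
    then show ?thesis by blast
  qed
  then obtain L where L0: "\<And>b. 0 \<le> L b"
    and L: "\<And>b p q. \<lbrakk>p \<in> C \<times> D; q \<in> C \<times> D\<rbrakk> \<Longrightarrow> norm (m' p (b, 0) - m' q (b, 0)) \<le> L b * norm (p - q)"
    by metis
  define K where "K = (\<Sum>b\<in>Basis. L b)"
  show ?thesis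
  proof (rule that)
    show "0 \<le> K" by (simp add: K_def sum_nonneg L0)
    fix x x' y y' assume xy: "x \<in> C" "x' \<in> C" "y \<in> D" "y' \<in> D"
    have derh: "((\<lambda>x. m (x, y) - m (x, y')) has_derivative (\<lambda>v. m' (z, y) (v, 0) - m' (z, y') (v, 0))) (at z within C)"
      if z: "z \<in> C" for z
    proof -
      have *: "((\<lambda>x. m (x, w)) has_derivative (\<lambda>v. m' (z, w) (v, 0))) (at z within C)" if w: "w \<in> D" for w
      proof -
        have "((\<lambda>x. (x, w)) has_derivative (\<lambda>v. (v, 0))) (at z within C)"
          by (auto intro!: derivative_eq_intros)
        from has_derivative_compose[OF this, of m "m' (z, w)"] der[of "(z, w)"] z w show ?thesis by simp
      qed
      show ?thesis by (intro has_derivative_diff * xy)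
    qed
    have on: "onorm (\<lambda>v. m' (z, y) (v, 0) - m' (z, y') (v, 0)) \<le> K * norm (y - y')" if z: "z \<in> C" for z
    proof (rule onorm_le)
      fix v :: 'a
      have lin: "linear (\<lambda>v. m' (z, y) (v, 0) - m' (z, y') (v, 0))"
        using derh[OF z] has_derivative_linear by blast
      define g where "g v = m' (z, y) (v, 0) - m' (z, y') (v, 0)" for v
      have "g v = g (\<Sum>b\<in>Basis. (v \<bullet> b) *\<^sub>R b)" by (simp add: euclidean_representation)
      also have "\<dots> = (\<Sum>b\<in>Basis. (v \<bullet> b) *\<^sub>R g b)"
        using lin unfolding g_def[symmetric] by (simp add: linear_sum linear_scale)
      also have "norm \<dots> \<le> (\<Sum>b\<in>Basis. norm v * (L b * norm (y - y')))"
      proof (rule sum_norm_le)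
        fix b :: 'a assume b: "b \<in> Basis"
        have "norm (g b) \<le> L b * norm ((z, y) - (z, y'))"
          unfolding g_def by (rule L) (use z xy in auto)
        then have "norm (g b) \<le> L b * norm (y - y')" by (simp add: norm_Pair)
        then show "norm ((v \<bullet> b) *\<^sub>R g b) \<le> norm v * (L b * norm (y - y'))"
          using Basis_le_norm[OF b, of v] by (auto intro!: mult_mono)
      qed
      finally show "norm (m' (z, y) (v, 0) - m' (z, y') (v, 0)) \<le> K * norm (y - y') * norm v"
        by (simp add: K_def g_def sum_distrib_left sum_distrib_right mult_ac)
    qed
    have "norm ((m (x, y) - m (x, y')) - (m (x', y) - m (x', y'))) \<le> K * norm (y - y') * norm (x - x')"
      by (rule differentiable_bound[OF C(2) derh on xy(1) xy(2)])
    then show "norm (m (x, y) - m (x', y) - m (x, y') + m (x', y')) \<le> K * norm (x - x') * norm (y - y')"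
      by (simp add: algebra_simps)
  qed
qed

text \<open>The chart is translated so that the identity has coordinate 0. The radius
  \<open>r\<close> is such that addition, read in coordinates, is defined on a product of two closed
  balls; \<open>minus_U\<close> comes from continuity of negation.\<close>

lemma lie_group_local_group_chart:
  fixes \<A> :: "('g::{t2_space, topological_group_add}, 'e::euclidean_space) chart set"
  assumes G: "lie_group \<A>" and U: "(U, \<phi>) \<in> \<A>" "0 \<in> U"
  obtains r K \<delta> where
    "local_group_chart U (\<lambda>g. \<phi> g - \<phi> 0) (\<lambda>x. inv_into U \<phi> (x + \<phi> 0)) r K \<delta>"
proof -
  define inv where "inv = inv_into U \<phi>"
  have "is_chart (U, \<phi>)" using G U by (auto simp: lie_group_def smooth_atlas_def)
  then have openU: "open U" and openV: "open (\<phi> ` U)" and hom: "homeomorphism U (\<phi> ` U) \<phi> inv"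
    by (auto simp: is_chart_def inv_def)
  have contphi: "continuous_on U \<phi>" and continv: "continuous_on (\<phi> ` U) inv"
    using hom by (auto simp: homeomorphism_def)
  have inv_phi: "inv (\<phi> g) = g" if "g \<in> U" for g using hom that by (simp add: homeomorphism_def)
  have inv: "inv x \<in> U" "\<phi> (inv x) = x" if "x \<in> \<phi> ` U" for x using that by (auto simp: inv_phi)
  \<comment> \<open>Coordinates of the pairs whose sum stays in the chart: the domain on which
    addition is smooth in coordinates.\<close>
  define S where "S = map_prod \<phi> \<phi> ` (U \<times> U \<inter> (\<lambda>(x, y). x + y) -` U)"
  define m where "m = \<phi> \<circ> (\<lambda>(x, y). x + y) \<circ> inv_into (U \<times> U) (map_prod \<phi> \<phi>)"
  have "(U \<times> U, map_prod \<phi> \<phi>) \<in> product_atlas \<A> \<A>" using U by (auto simp: product_atlas_def)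
  then have "smooth_on S m"
    using G U unfolding lie_group_def smooth_map_def S_def m_def by blast
  then have m2: "k_smooth_on (Suc (Suc 0)) S m" unfolding smooth_on_def by blast
  have inj: "inj_on (map_prod \<phi> \<phi>) (U \<times> U)"
    by (auto simp: inj_on_def) (metis inv_phi)+
  have m_eq: "m (\<phi> a, \<phi> b) = \<phi> (a + b)" if "a \<in> U" "b \<in> U" for a b
  proof -
    have "inv_into (U \<times> U) (map_prod \<phi> \<phi>) (map_prod \<phi> \<phi> (a, b)) = (a, b)"
      by (rule inv_into_f_f[OF inj]) (use that in auto)
    then show ?thesis by (simp add: m_def)
  qed
  have S_iff: "(\<phi> a, \<phi> b) \<in> S \<longleftrightarrow> a + b \<in> U" if "a \<in> U" "b \<in> U" for a b
    using that by (auto simp: S_def) (metis inv_phi)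
  have "S = (\<phi> ` U \<times> \<phi> ` U) \<inter> (\<lambda>p. inv (fst p) + inv (snd p)) -` U"
    by (auto simp: S_def inv_phi)
  moreover have "open \<dots>"
    by (intro continuous_open_preimage continuous_intros open_Times openV openU
        continuous_on_compose2[OF continv]) auto
  ultimately have "open S" by simp
  moreover have "(\<phi> 0, \<phi> 0) \<in> S" using S_iff[OF U(2) U(2)] U(2) by simp
  ultimately obtain A B where AB: "open A" "open B" "\<phi> 0 \<in> A" "\<phi> 0 \<in> B" "A \<times> B \<subseteq> S"
    by (metis SigmaD1 SigmaD2 open_prod_elim)
  have "open (A \<inter> B)" "\<phi> 0 \<in> A \<inter> B" using AB by auto
  then obtain r where r: "r > 0" "cball (\<phi> 0) r \<subseteq> A \<inter> B" by (metis open_contains_cball)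
  have CS: "cball (\<phi> 0) r \<times> cball (\<phi> 0) r \<subseteq> S" using r AB(5) by blast
  have CV: "cball (\<phi> 0) r \<subseteq> \<phi> ` U"
  proof
    fix x assume "x \<in> cball (\<phi> 0) r"
    then have "(x, x) \<in> S" using CS by blast
    then show "x \<in> \<phi> ` U" by (auto simp: S_def)
  qed
  obtain K where K: "0 \<le> K" and mixed: "\<And>x x' y y'.
      \<lbrakk>x \<in> cball (\<phi> 0) r; x' \<in> cball (\<phi> 0) r; y \<in> cball (\<phi> 0) r; y' \<in> cball (\<phi> 0) r\<rbrakk> \<Longrightarrow>
      norm (m (x, y) - m (x', y) - m (x, y') + m (x', y')) \<le> K * norm (x - x') * norm (y - y')"
    by (rule k_smooth_mixed_difference_bound[OF m2 _ _ _ _ CS]) (use compact_cball convex_cball in blast)+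
  have cb: "\<phi> g \<in> cball (\<phi> 0) r \<longleftrightarrow> norm (\<phi> g - \<phi> 0) \<le> r" for g
    by (simp add: dist_norm norm_minus_commute)
  \<comment> \<open>Coordinates of the elements whose negative lies in the chart within distance
    \<open>r\<close> of the identity.\<close>
  define Q where "Q = \<phi> ` U \<inter> inv -` (U \<inter> uminus -` (U \<inter> \<phi> -` ball (\<phi> 0) r))"
  have "open (U \<inter> \<phi> -` ball (\<phi> 0) r)" by (intro continuous_open_preimage contphi openU open_ball)
  moreover have "continuous_on UNIV (uminus :: 'g \<Rightarrow> 'g)"
    by (auto simp: continuous_on_def intro!: tendsto_minus tendsto_ident_at)
  ultimately have "open (uminus -` (U \<inter> \<phi> -` ball (\<phi> 0) r))" by (rule open_vimage)
  then have "open Q" unfolding Q_def by (intro continuous_open_preimage continv openV open_Int openU)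
  moreover have "\<phi> 0 \<in> Q" using U r by (auto simp: Q_def inv_phi)
  ultimately obtain \<rho> where \<rho>: "\<rho> > 0" "cball (\<phi> 0) \<rho> \<subseteq> Q" by (metis open_contains_cball)
  \<comment> \<open>The three terms serve \<open>minus_U\<close>, \<open>\<delta>_r\<close> and
    \<open>\<delta>_K\<close>; \<open>K + 1\<close> is there because \<open>K\<close> may
    vanish.\<close>
  define \<delta> where "\<delta> = min \<rho> (min (r / 4) (1 / (8 * (K + 1))))"
  have "8 * K * \<delta> \<le> 8 * K * (1 / (8 * (K + 1)))"
    using K by (intro mult_left_mono) (auto simp: \<delta>_def)
  also have "\<dots> \<le> 1" using K by (simp add: divide_le_eq)
  finally have \<delta>K: "8 * K * \<delta> \<le> 1" .
  have "local_group_chart U (\<lambda>g. \<phi> g - \<phi> 0) (\<lambda>x. inv (x + \<phi> 0)) r K \<delta>"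
  proof
    show "continuous_on U (\<lambda>g. \<phi> g - \<phi> 0)" by (intro continuous_intros contphi)
    show "continuous_on (cball 0 r) (\<lambda>x. inv (x + \<phi> 0))"
    proof (rule continuous_on_compose2[OF continv])
      show "(\<lambda>x. x + \<phi> 0) ` cball 0 r \<subseteq> \<phi> ` U"
        using CV by (auto simp: dist_norm subset_eq norm_minus_commute)
    qed (intro continuous_intros)
    have V: "x + \<phi> 0 \<in> \<phi> ` U" if "norm x \<le> r" for x
      using that CV by (auto simp: dist_norm subset_eq)
    show "inv (x + \<phi> 0) \<in> U" "\<phi> (inv (x + \<phi> 0)) - \<phi> 0 = x" if "norm x \<le> r" for x
      using inv[OF V[OF that]] by auto
    show "a + b \<in> U" if "a \<in> U" "b \<in> U" "norm (\<phi> a - \<phi> 0) \<le> r" "norm (\<phi> b - \<phi> 0) \<le> r" for a b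
      using that S_iff CS cb by blast
    show "norm (\<phi> (a + b) - \<phi> 0 - (\<phi> (a' + b) - \<phi> 0) - (\<phi> (a + b') - \<phi> 0) + (\<phi> (a' + b') - \<phi> 0))
        \<le> K * norm (\<phi> a - \<phi> 0 - (\<phi> a' - \<phi> 0)) * norm (\<phi> b - \<phi> 0 - (\<phi> b' - \<phi> 0))"
      if "a \<in> U" "a' \<in> U" "b \<in> U" "b' \<in> U" "norm (\<phi> a - \<phi> 0) \<le> r" "norm (\<phi> a' - \<phi> 0) \<le> r"
        "norm (\<phi> b - \<phi> 0) \<le> r" "norm (\<phi> b' - \<phi> 0) \<le> r" for a a' b b'
      using mixed[OF that(5-8)[folded cb]] that(1-4) by (simp add: m_eq)
    show "- g \<in> U \<and> norm (\<phi> (- g) - \<phi> 0) \<le> r" if "g \<in> U" "norm (\<phi> g - \<phi> 0) \<le> \<delta>" for g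
    proof -
      have "\<phi> g \<in> cball (\<phi> 0) \<rho>" using that by (auto simp: \<delta>_def dist_norm norm_minus_commute)
      then have "\<phi> g \<in> Q" using \<rho> by blast
      then show ?thesis using that by (auto simp: Q_def inv_phi dist_norm norm_minus_commute)
    qed
    show "0 < \<delta>" using \<rho> r K by (simp add: \<delta>_def)
    show "4 * \<delta> \<le> r" by (simp add: \<delta>_def)
  qed (use openU U inv_phi K \<delta>K in auto)
  then show ?thesis using that by (simp add: inv_def)
qed

lemma continuous_on_lie_exp:
  fixes \<A> :: "('g::{t2_space, topological_group_add}, 'e::euclidean_space) chart set"
  assumes "lie_group \<A>" "(U, \<phi>) \<in> \<A>" "0 \<in> U"
  shows "continuous_on UNIV (lie_exp \<phi>)"
proof -
  obtain r K \<delta> where "local_group_chart U (\<lambda>g. \<phi> g - \<phi> 0) (\<lambda>x. inv_into U \<phi> (x + \<phi> 0)) r K \<delta>"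
    using lie_group_local_group_chart[OF assms] .
  then interpret local_group_chart U "\<lambda>g. \<phi> g - \<phi> 0" "\<lambda>x. inv_into U \<phi> (x + \<phi> 0)" r K \<delta> .
  show ?thesis using continuous_on_global_exp lie_exp_eq_global_exp[of "\<phi> 0"] by simp
qed

text \<open>Pulled back along \<open>v \<mapsto> span {v}\<close>, the condition says that
  \<open>f (t *\<^sub>R v)\<close> lies in \<open>W\<close> for some \<open>t\<close>, and each
  single \<open>t\<close> gives an open set of \<open>v\<close>.\<close>

lemma openin_projective_space_hitting:
  fixes f :: "'e::euclidean_space \<Rightarrow> 'b::topological_space"
  assumes f: "continuous_on UNIV f" and W: "open W"
  shows "openin projective_space {\<theta> \<in> lines. \<exists>g\<in>f ` \<theta>. g \<in> W}"
proof -
  have "span {v} \<in> lines" if "v \<noteq> 0" for v :: 'e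
    using that by (simp add: lines_def dim_span dim_singleton subspace_span)
  then have "{v. v \<noteq> 0 \<and> span {v} \<in> {\<theta> \<in> lines. \<exists>g\<in>f ` \<theta>. g \<in> W}}
      = - {0} \<inter> (\<Union>t. (\<lambda>v. f (t *\<^sub>R v)) -` W)"
    by (auto simp: span_singleton)
  moreover have "open ((\<lambda>v. f (t *\<^sub>R v)) -` W)" for t
    by (intro open_vimage W continuous_on_compose2[OF f] continuous_intros) auto
  then have "open (- {0} \<inter> (\<Union>t. (\<lambda>v. f (t *\<^sub>R v)) -` W))"
    by (intro open_Int open_UN ballI open_Compl) auto
  ultimately show ?thesis by (auto simp: openin_projective_space)
qed

section \<open>Countable dense families of sets\<close>

text \<open>Choosing a basic open set that isolates each point injects the set into a countable
  basis. This makes the lattice countable.\<close>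

lemma countable_discrete:
  fixes S :: "'a::second_countable_topology set"
  assumes "discrete S"
  shows "countable S"
proof -
  obtain B :: "'a set set" where B: "countable B" "topological_basis B" by (metis ex_countable_basis)
  have "\<exists>V\<in>B. V \<inter> S = {x}" if "x \<in> S" for x
  proof -
    obtain W where W: "open W" "W \<inter> S = {x}"
      using assms \<open>x \<in> S\<close> by (auto simp: discrete_def isolated_in_def)
    then obtain V where "V \<in> B" "x \<in> V" "V \<subseteq> W" using B(2) topological_basisE by (metis Int_iff insertI1)
    then show ?thesis using W \<open>x \<in> S\<close> by blast
  qed
  then obtain V where V: "\<And>x. x \<in> S \<Longrightarrow> V x \<in> B \<and> V x \<inter> S = {x}" by metis
  then have "inj_on V S" by (metis inj_onI singleton_inject)
  moreover have "countable (V ` S)" using V B(1) by (metis countable_subset image_subsetI)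
  ultimately show ?thesis using countable_image_inj_on by blast
qed

text \<open>The approximable sets form a \<sigma>-algebra. Complements keep the symmetric
  difference. A countable union is cut off after \<open>n\<close> sets at a cost below
  \<open>e / 2\<close>, and the \<open>n\<close> sets are approximated within
  \<open>e / (2 * (n + 1))\<close> each, where \<open>n + 1\<close> covers
  \<open>n = 0\<close>.\<close>

lemma (in finite_measure) approximation_by_algebra:
  assumes gen: "sets M = sigma_sets (space M) \<C>" and alg: "algebra (space M) \<A>"
    and sub: "\<C> \<subseteq> \<A>" "\<A> \<subseteq> sets M" and A: "A \<in> sets M"
  shows "0 < e \<Longrightarrow> \<exists>B\<in>\<A>. measure M (A - B \<union> (B - A)) < e"
proof -
  interpret algebra "space M" \<A> by (rule alg)
  have "A \<in> sigma_sets (space M) \<C>" using A gen by simp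
  then show "0 < e \<Longrightarrow> \<exists>B\<in>\<A>. measure M (A - B \<union> (B - A)) < e"
  proof (induction arbitrary: e)
    case (Basic a)
    then show ?case using sub by (intro bexI[of _ a]) auto
  next
    case Empty
    then show ?case by (intro bexI[of _ "{}"]) auto
  next
    case (Compl a)
    then obtain B where B: "B \<in> \<A>" "measure M (a - B \<union> (B - a)) < e" by blast
    have a: "a \<in> sets M" using Compl gen by simp
    have "measure M ((space M - a) - (space M - B) \<union> ((space M - B) - (space M - a)))
        \<le> measure M (a - B \<union> (B - a))"
      using a B sub by (intro finite_measure_mono) auto
    then show ?case using B by (intro bexI[of _ "space M - B"]) auto
  next
    case (Union a)
    have a: "a i \<in> sets M" for i using Union gen by simp
    define u where "u n = (\<Union>i<n. a i)" for n
    have u: "u n \<in> sets M" for n using a by (auto simp: u_def)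
    have "incseq u" unfolding incseq_def u_def by (meson UN_mono lessThan_subset_iff order_refl)
    then have "(\<lambda>n. measure M (u n)) \<longlonglongrightarrow> measure M (\<Union>n. u n)"
      using u by (intro finite_Lim_measure_incseq) auto
    moreover have un: "(\<Union>n. u n) = (\<Union>i. a i)" by (auto simp: u_def)
    ultimately have "(\<lambda>n. measure M (u n)) \<longlonglongrightarrow> measure M (\<Union>i. a i)" by simp
    then have "\<forall>\<^sub>F n in sequentially. measure M (\<Union>i. a i) - e / 2 < measure M (u n)"
      using Union.prems by (intro order_tendstoD(1)) auto
    then obtain n where n: "measure M (\<Union>i. a i) - e / 2 < measure M (u n)"
      by (auto simp: eventually_sequentially)
    have "measure M ((\<Union>i. a i) - u n) = measure M (\<Union>i. a i) - measure M (u n)"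
      using a u un by (intro finite_measure_Diff) auto
    then have d: "measure M ((\<Union>i. a i) - u n) < e / 2" using n by simp
    have "\<forall>i. \<exists>B\<in>\<A>. measure M (a i - B \<union> (B - a i)) < e / (2 * (real n + 1))"
      using Union by (auto intro!: divide_pos_pos)
    then obtain B where B: "\<And>i. B i \<in> \<A>"
      "\<And>i. measure M (a i - B i \<union> (B i - a i)) < e / (2 * (real n + 1))" by metis
    have BM: "B i \<in> sets M" for i using B sub by blast
    define C where "C = (\<Union>i<n. B i)"
    have C: "C \<in> \<A>" unfolding C_def using B by (intro finite_UN) auto
    have "measure M ((\<Union>i. a i) - C \<union> (C - (\<Union>i. a i)))
        \<le> measure M (((\<Union>i. a i) - u n) \<union> (\<Union>i<n. a i - B i \<union> (B i - a i)))"
      using a u BM by (intro finite_measure_mono) (auto simp: C_def u_def)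
    also have "\<dots> \<le> measure M ((\<Union>i. a i) - u n) + measure M (\<Union>i<n. a i - B i \<union> (B i - a i))"
      using a u BM by (intro measure_Un_le) auto
    also have "measure M (\<Union>i<n. a i - B i \<union> (B i - a i)) \<le> (\<Sum>i<n. measure M (a i - B i \<union> (B i - a i)))"
      using a BM by (intro measure_UNION_le) auto
    also have "\<dots> \<le> (\<Sum>i<n. e / (2 * (real n + 1)))" using B(2) by (intro sum_mono less_imp_le)
    also have "\<dots> \<le> e / 2" using Union.prems by (simp add: field_simps)
    finally have "measure M ((\<Union>i. a i) - C \<union> (C - (\<Union>i. a i))) < e" using d by simp
    then show ?case using C by blast
  qed
qed

text \<open>The generated algebra, built in cumulative stages of one complement or one binary union
  each. Every stage is visibly countable, and two sets from different stages lie in a common later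
  one.\<close>

primrec algebra_stage :: "'a set \<Rightarrow> 'a set set \<Rightarrow> nat \<Rightarrow> 'a set set" where
  "algebra_stage \<Omega> \<C> 0 = insert {} \<C>"
| "algebra_stage \<Omega> \<C> (Suc n) = algebra_stage \<Omega> \<C> n \<union> (-) \<Omega> ` algebra_stage \<Omega> \<C> n \<union>
     (\<lambda>(a, b). a \<union> b) ` (algebra_stage \<Omega> \<C> n \<times> algebra_stage \<Omega> \<C> n)"

lemma countable_algebra:
  assumes "countable \<C>" "\<C> \<subseteq> Pow \<Omega>"
  obtains \<A> where "countable \<A>" "algebra \<Omega> \<A>" "\<C> \<subseteq> \<A>" "\<A> \<subseteq> sigma_sets \<Omega> \<C>"
proof
  let ?A = "algebra_stage \<Omega> \<C>"
  have "countable (?A n)" for n by (induction n) (use assms in auto)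
  then show "countable (\<Union>n. ?A n)" by simp
  have sub: "?A n \<subseteq> sigma_sets \<Omega> \<C>" for n
    by (induction n) (auto intro: sigma_sets.intros sigma_sets_Un)
  then show "(\<Union>n. ?A n) \<subseteq> sigma_sets \<Omega> \<C>" by blast
  show "\<C> \<subseteq> (\<Union>n. ?A n)"
  proof
    fix c assume "c \<in> \<C>"
    then have "c \<in> ?A 0" by simp
    then show "c \<in> (\<Union>n. ?A n)" by blast
  qed
  have mono: "?A m \<subseteq> ?A n" if "m \<le> n" for m n
    using that by (rule lift_Suc_mono_le[rotated]) auto
  show "algebra \<Omega> (\<Union>n. ?A n)"
    unfolding algebra_iff_Un
  proof (intro conjI ballI)
    show "(\<Union>n. ?A n) \<subseteq> Pow \<Omega>"
      using sub sigma_sets_into_sp[OF assms(2)] by (meson PowI UN_least subsetD subsetI)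
    have "{} \<in> ?A 0" by simp
    then show "{} \<in> (\<Union>n. ?A n)" by blast
    fix a assume "a \<in> (\<Union>n. ?A n)"
    then obtain m where m: "a \<in> ?A m" by blast
    then have "\<Omega> - a \<in> ?A (Suc m)" by simp
    then show "\<Omega> - a \<in> (\<Union>n. ?A n)" by blast
    fix b assume "b \<in> (\<Union>n. ?A n)"
    then obtain n where n: "b \<in> ?A n" by blast
    have "a \<in> ?A (max m n)" "b \<in> ?A (max m n)" using m n mono[of m "max m n"] mono[of n "max m n"] by auto
    then have "a \<union> b \<in> ?A (Suc (max m n))" by auto
    then show "a \<union> b \<in> (\<Union>n. ?A n)" by blast
  qed
qed

text \<open>The family consists of the \<open>B \<inter> F k\<close> with \<open>B\<close> from a
  countable generating algebra and \<open>F\<close> an increasing exhaustion by sets of finite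
  measure. Half of the error pays for the part of \<open>A\<close> outside \<open>F k\<close>, the
  other half for approximation in the finite measure restricted to \<open>F k\<close>.\<close>

lemma (in sigma_finite_measure) countable_dense_sets:
  assumes C: "countable \<C>" "\<C> \<subseteq> Pow (space M)" and gen: "sets M = sigma_sets (space M) \<C>"
  obtains D :: "nat \<Rightarrow> 'a set" where "\<And>n. D n \<in> sets M" "\<And>n. emeasure M (D n) < \<infinity>"
    "\<And>A e. \<lbrakk>A \<in> sets M; emeasure M A < \<infinity>; 0 < e\<rbrakk> \<Longrightarrow> \<exists>n. emeasure M (A - D n \<union> (D n - A)) < ennreal e"
proof -
  obtain \<A> where \<A>: "countable \<A>" "algebra (space M) \<A>" "\<C> \<subseteq> \<A>" "\<A> \<subseteq> sets M"
    using countable_algebra[OF C] gen by metis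
  obtain F :: "nat \<Rightarrow> 'a set" where F: "range F \<subseteq> sets M" "(\<Union>i. F i) = space M"
    "\<And>i. emeasure M (F i) \<noteq> \<infinity>" "incseq F"
    using sigma_finite_incseq by metis
  define \<D> where "\<D> = (\<lambda>(B, k). B \<inter> F k) ` (\<A> \<times> UNIV)"
  have "{} \<in> \<A>" using \<A>(2) by (simp add: algebra_iff_Un)
  then have "\<D> \<noteq> {}" by (auto simp: \<D>_def)
  moreover have "countable \<D>" using \<A>(1) by (simp add: \<D>_def)
  ultimately have ran: "range (from_nat_into \<D>) = \<D>" by (rule range_from_nat_into)
  have \<D>: "d \<in> sets M \<and> emeasure M d < \<infinity>" if d: "d \<in> \<D>" for d
  proof -
    obtain B k where "d = B \<inter> F k" "B \<in> \<A>" using d by (auto simp: \<D>_def)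
    then show ?thesis
      using \<A>(4) F(1) F(3)[of k] emeasure_mono[of "B \<inter> F k" "F k" M] by (auto simp: less_top top_unique)
  qed
  have dense: "\<exists>d\<in>\<D>. emeasure M (A - d \<union> (d - A)) < ennreal e"
    if A: "A \<in> sets M" "emeasure M A < \<infinity>" and e: "0 < e" for A e
  proof -
    have "(\<lambda>i. emeasure M (A - F i)) \<longlonglongrightarrow> emeasure M (\<Inter>i. A - F i)"
    proof (rule Lim_emeasure_decseq)
      show "range (\<lambda>i. A - F i) \<subseteq> sets M" using A F(1) by auto
      show "decseq (\<lambda>i. A - F i)" using F(4) by (auto simp: incseq_def decseq_def)
      show "emeasure M (A - F i) \<noteq> \<infinity>" for i
        using A F(1) emeasure_mono[of "A - F i" A M] by (auto simp: less_top top_unique)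
    qed
    moreover have "(\<Inter>i. A - F i) = {}" using F(2) sets.sets_into_space[OF A(1)] by blast
    ultimately have "(\<lambda>i. emeasure M (A - F i)) \<longlonglongrightarrow> 0" by (simp only: emeasure_empty)
    then have "\<forall>\<^sub>F i in sequentially. emeasure M (A - F i) < ennreal (e / 2)"
      using e by (intro order_tendstoD(2)) auto
    then obtain k where k: "emeasure M (A - F k) < ennreal (e / 2)" by (auto simp: eventually_sequentially)
    have Fk: "F k \<in> sets M" using F(1) by auto
    define N where "N = density M (indicator (F k))"
    have N: "sets N = sets M" "space N = space M" by (simp_all add: N_def)
    have emN: "emeasure N S = emeasure M (F k \<inter> S)" if "S \<in> sets M" for S
      unfolding N_def using Fk that by (rule emeasure_restricted)
    interpret N: finite_measure N
      by standard (use emN[of "space M"] F(3)[of k] Fk in \<open>simp add: N sets.Int_space_eq2\<close>)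
    obtain B where B: "B \<in> \<A>" "measure N (A - B \<union> (B - A)) < e / 2"
      using N.approximation_by_algebra[of \<C> \<A> A "e / 2"] \<A> A e gen by (auto simp: N)
    have BM: "B \<in> sets M" using B \<A> by blast
    have "emeasure M (F k \<inter> (A - B \<union> (B - A))) = ennreal (measure N (A - B \<union> (B - A)))"
      using emN[of "A - B \<union> (B - A)"] A BM by (simp add: N.emeasure_eq_measure)
    also have "\<dots> < ennreal (e / 2)" using B(2) e by (intro ennreal_lessI) auto
    finally have "emeasure M (F k \<inter> (A - B \<union> (B - A))) < ennreal (e / 2)" .
    then have "emeasure M (A - F k) + emeasure M (F k \<inter> (A - B \<union> (B - A))) < ennreal (e / 2) + ennreal (e / 2)"
      using k by (rule add_strict_mono[rotated])
    also have "\<dots> = ennreal e" using e by (simp flip: ennreal_plus)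
    finally have "emeasure M (A - F k) + emeasure M (F k \<inter> (A - B \<union> (B - A))) < ennreal e" .
    moreover have "emeasure M (A - B \<inter> F k \<union> (B \<inter> F k - A)) \<le> emeasure M ((A - F k) \<union> F k \<inter> (A - B \<union> (B - A)))"
      using A BM Fk by (intro emeasure_mono) auto
    moreover have "emeasure M ((A - F k) \<union> F k \<inter> (A - B \<union> (B - A)))
        \<le> emeasure M (A - F k) + emeasure M (F k \<inter> (A - B \<union> (B - A)))"
      using A BM Fk by (intro emeasure_subadditive) auto
    moreover have "B \<inter> F k \<in> \<D>" using B by (auto simp: \<D>_def)
    ultimately show ?thesis by (meson le_less_trans order_trans)
  qed
  show ?thesis
  proof (rule that)
    show "from_nat_into \<D> n \<in> sets M" "emeasure M (from_nat_into \<D> n) < \<infinity>" for n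
      using \<D> ran by blast+
    show "\<exists>n. emeasure M (A - from_nat_into \<D> n \<union> (from_nat_into \<D> n - A)) < ennreal e"
      if "A \<in> sets M" "emeasure M A < \<infinity>" "0 < e" for A e
      using dense[OF that] ran by (metis imageE)
  qed
qed

lemma standard_measure_space_generator:
  assumes "standard_measure_space M"
  obtains \<C> where "countable \<C>" "\<C> \<subseteq> Pow (space M)" "sets M = sigma_sets (space M) \<C>"
proof -
  obtain X where X: "topspace X = space M" "second_countable X" "sets M = sigma_sets (space M) {U. openin X U}"
    using assms by (auto simp: standard_measure_space_def)
  obtain \<C> where \<C>: "countable \<C>" "\<And>V. V \<in> \<C> \<Longrightarrow> openin X V"
    "\<And>U x. openin X U \<and> x \<in> U \<Longrightarrow> \<exists>V\<in>\<C>. x \<in> V \<and> V \<subseteq> U"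
    using X(2) by (auto simp: second_countable_def)
  have "U \<in> sigma_sets (space M) \<C>" if U: "openin X U" for U
  proof -
    have eq: "U = \<Union>{V \<in> \<C>. V \<subseteq> U}" using \<C>(3) U by blast
    have "countable {V \<in> \<C>. V \<subseteq> U}" by (rule countable_subset[OF _ \<C>(1)]) blast
    then show ?thesis by (subst eq, intro sigma_sets_UNION) auto
  qed
  then have "sets M = sigma_sets (space M) \<C>"
    unfolding X(3) by (intro sigma_sets_eqI) (use \<C>(2) in auto)
  moreover have "\<C> \<subseteq> Pow (space M)" using openin_subset[OF \<C>(2)] X(1) by auto
  ultimately show ?thesis using \<C>(1) by (intro that[of \<C>])
qed

section \<open>Measure preserving actions of countable groups\<close>

locale countable_group_action = sigma_finite_measure M
  for M :: "'x measure" +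
  fixes \<Gamma> :: "'g::group_add set" and T :: "'g \<Rightarrow> 'x \<Rightarrow> 'x"
  assumes subgroup: "add_subgroup \<Gamma>" and countable_group: "countable \<Gamma>"
    and action: "measure_preserving_action \<Gamma> M T"
begin

lemma minus_closed: "\<gamma> \<in> \<Gamma> \<Longrightarrow> - \<gamma> \<in> \<Gamma>"
  using subgroup by (simp add: add_subgroup_def)

lemma T_space: "\<lbrakk>\<gamma> \<in> \<Gamma>; x \<in> space M\<rbrakk> \<Longrightarrow> T \<gamma> x \<in> space M"
  using action measurable_space[of "T \<gamma>" M M x] by (simp add: measure_preserving_action_def)

lemma T_minus:
  assumes "\<gamma> \<in> \<Gamma>" "x \<in> space M"
  shows "T (- \<gamma>) (T \<gamma> x) = x" "T \<gamma> (T (- \<gamma>) x) = x"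
  using action assms minus_closed[OF assms(1)] unfolding measure_preserving_action_def
  by (metis left_minus, metis right_minus)

text \<open>Recurrence and rigidity speak of images, whereas measurability and invariance are
  assumed for preimages; inverses in the group translate between the two.\<close>

lemma T_image:
  assumes g: "\<gamma> \<in> \<Gamma>" and A: "A \<subseteq> space M"
  shows "T \<gamma> ` A = T (- \<gamma>) -` A \<inter> space M"
proof (intro equalityI subsetI)
  fix y assume "y \<in> T \<gamma> ` A"
  then obtain x where "x \<in> A" "y = T \<gamma> x" by blast
  then show "y \<in> T (- \<gamma>) -` A \<inter> space M" using A T_space[OF g] T_minus(1)[OF g] by auto
next
  fix y assume y: "y \<in> T (- \<gamma>) -` A \<inter> space M"
  then have "y = T \<gamma> (T (- \<gamma>) y)" using T_minus(2)[OF g] by simp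
  then show "y \<in> T \<gamma> ` A" using y by blast
qed

lemma T_vimage_sets: "\<lbrakk>\<gamma> \<in> \<Gamma>; A \<in> sets M\<rbrakk> \<Longrightarrow> T \<gamma> -` A \<inter> space M \<in> sets M"
  using action unfolding measure_preserving_action_def by (blast intro: measurable_sets)

lemma T_image_sets: "\<lbrakk>\<gamma> \<in> \<Gamma>; A \<in> sets M\<rbrakk> \<Longrightarrow> T \<gamma> ` A \<in> sets M"
  using T_image[of \<gamma> A] T_vimage_sets[OF minus_closed[of \<gamma>], of A] sets.sets_into_space[of A M] by simp

lemma emeasure_T_image: "\<lbrakk>\<gamma> \<in> \<Gamma>; A \<in> sets M\<rbrakk> \<Longrightarrow> emeasure M (T \<gamma> ` A) = emeasure M A"
  using action minus_closed[of \<gamma>] T_image[of \<gamma> A] sets.sets_into_space[of A M]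
  by (simp add: measure_preserving_action_def)

lemma T_image_Diff:
  assumes "\<gamma> \<in> \<Gamma>" "A \<subseteq> space M" "B \<subseteq> space M"
  shows "T \<gamma> ` A - T \<gamma> ` B = T \<gamma> ` (A - B)"
proof -
  have "inj_on (T \<gamma>) (space M)" by (rule inj_on_inverseI[of _ "T (- \<gamma>)"]) (use assms T_minus in auto)
  then show ?thesis using assms inj_on_image_set_diff[of "T \<gamma>" "space M" A B] by auto
qed

text \<open>Outside \<open>D - T \<gamma>\<close> D\<open>, a point of\<close>A - T \<gamma>
  \<open>A\<close> lies in \<open>A - D\<close> or in the image of \<open>D - A\<close>, and
  invariance gives that image the measure of \<open>D - A\<close>. The defect is thus stable under
  approximation, uniformly in \<gamma>.\<close>

lemma defect_perturbation:
  assumes g: "\<gamma> \<in> \<Gamma>" and A: "A \<in> sets M" and D: "D \<in> sets M"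
  shows "emeasure M (A - T \<gamma> ` A) \<le> emeasure M (D - T \<gamma> ` D) + emeasure M (A - D \<union> (D - A))"
proof -
  note m = T_image_sets[OF g A] T_image_sets[OF g D]
  have sp: "A \<subseteq> space M" "D \<subseteq> space M" using A D sets.sets_into_space by auto
  have "emeasure M (A - T \<gamma> ` A) \<le> emeasure M ((D - T \<gamma> ` D) \<union> ((A - D) \<union> (T \<gamma> ` D - T \<gamma> ` A)))"
    using m A D by (intro emeasure_mono) auto
  also have "\<dots> \<le> emeasure M (D - T \<gamma> ` D) + emeasure M ((A - D) \<union> (T \<gamma> ` D - T \<gamma> ` A))"
    using m A D by (intro emeasure_subadditive) auto
  also have "\<dots> \<le> emeasure M (D - T \<gamma> ` D) + (emeasure M (A - D) + emeasure M (T \<gamma> ` D - T \<gamma> ` A))"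
    using m A D by (intro add_left_mono emeasure_subadditive) auto
  also have "emeasure M (T \<gamma> ` D - T \<gamma> ` A) = emeasure M (D - A)"
    using T_image_Diff[OF g sp(2,1)] emeasure_T_image[OF g, of "D - A"] A D by simp
  also have "emeasure M (A - D) + emeasure M (D - A) = emeasure M (A - D \<union> (D - A))"
    using A D by (intro plus_emeasure) auto
  finally show ?thesis .
qed

text \<open>Finite measure allows passing to the complementary defect, for which
  \<open>defect_perturbation\<close> is available.\<close>

lemma tendsto_intersection_iff:
  assumes g: "\<And>n. \<gamma> n \<in> \<Gamma>" and A: "A \<in> sets M" "emeasure M A < \<infinity>"
  shows "((\<lambda>n. emeasure M (A \<inter> T (\<gamma> n) ` A)) \<longlongrightarrow> emeasure M A) F \<longleftrightarrow>
    ((\<lambda>n. emeasure M (A - T (\<gamma> n) ` A)) \<longlongrightarrow> 0) F"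
proof -
  note m = T_image_sets[OF g A(1)]
  have eq: "emeasure M (A \<inter> T (\<gamma> n) ` A) + emeasure M (A - T (\<gamma> n) ` A) = emeasure M A" for n
    using A m[of n] by (subst plus_emeasure) (auto intro!: arg_cong[of _ _ "emeasure M"])
  have fin: "emeasure M A \<noteq> top" using A by auto
  have fin2: "emeasure M (A \<inter> T (\<gamma> n) ` A) \<noteq> top" "emeasure M (A - T (\<gamma> n) ` A) \<noteq> top" for n
    using eq[of n] fin by (metis ennreal_add_eq_top)+
  have e1: "emeasure M (A \<inter> T (\<gamma> n) ` A) = emeasure M A - emeasure M (A - T (\<gamma> n) ` A)" for n
    using eq[of n] fin2 by (metis ennreal_add_diff_cancel_right)
  have e2: "emeasure M (A - T (\<gamma> n) ` A) = emeasure M A - emeasure M (A \<inter> T (\<gamma> n) ` A)" for n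
    using eq[of n] fin2 by (metis ennreal_add_diff_cancel_left)
  show ?thesis
  proof
    assume "((\<lambda>n. emeasure M (A \<inter> T (\<gamma> n) ` A)) \<longlongrightarrow> emeasure M A) F"
    from tendsto_diff_ennreal[OF tendsto_const this, of "emeasure M A"] fin
    show "((\<lambda>n. emeasure M (A - T (\<gamma> n) ` A)) \<longlongrightarrow> 0) F" by (simp add: e2 ennreal_minus_eq_0 diff_eq_0_ennreal)
  next
    assume "((\<lambda>n. emeasure M (A - T (\<gamma> n) ` A)) \<longlongrightarrow> 0) F"
    from tendsto_diff_ennreal[OF tendsto_const this, of "emeasure M A"] fin
    show "((\<lambda>n. emeasure M (A \<inter> T (\<gamma> n) ` A)) \<longlongrightarrow> emeasure M A) F" by (simp add: e1)
  qed
qed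

end

section \<open>Recurrence and rigidity\<close>

text \<open>Origin of the constant 7. Here \<open>a\<close> and \<open>d\<close> are the measures of
  a set and its approximant, \<open>s\<close> that of their symmetric difference, and
  \<open>p\<close> that of the domain of a matching of the approximant:
  \<open>a \<le> d + s \<le> 3 * (2 * s) + s\<close>.\<close>

lemma matching_arith:
  fixes a d p s :: ennreal
  assumes "a \<le> d + s" "d < 3 * p" "p \<le> s + s" "7 * s < a"
  shows False
proof -
  have "d \<le> 3 * (s + s)" using assms(2,3) by (meson dual_order.strict_trans1 less_imp_le mult_left_mono zero_le)
  then have "a \<le> 3 * (s + s) + s" using assms(1) by (meson add_right_mono order_trans)
  also have "\<dots> = (3 + 3 + 1) * s" by (simp only: distrib_left distrib_right mult_1)
  also have "\<dots> = 7 * s" by simp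
  finally show False using assms(4) by simp
qed

context countable_group_action
begin

text \<open>
  A matching is a partial injection \<open>x \<mapsto> T (g j) x\<close> on \<open>P j\<close> from \<open>A\<close> into \<open>A\<close> whose domain
  fills more than a third of \<open>A\<close>.
\<close>

definition matching :: "nat \<Rightarrow> (nat \<Rightarrow> 'g) \<Rightarrow> (nat \<Rightarrow> 'x set) \<Rightarrow> 'x set \<Rightarrow> bool" where
  "matching k g P A \<longleftrightarrow>
     (\<forall>j<k. g j \<in> \<Gamma> \<and> P j \<in> sets M \<and> P j \<subseteq> A \<and> T (g j) ` P j \<subseteq> A) \<and>
     disjoint_family_on P {..<k} \<and> disjoint_family_on (\<lambda>j. T (g j) ` P j) {..<k} \<and>
     emeasure M A < 3 * emeasure M (\<Union>j<k. P j)"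

text \<open>The pair consists of the points of \<open>A\<close> not yet used as sources and those not yet used as
  targets; these two sets may overlap.\<close>

primrec greedy :: "(nat \<Rightarrow> 'g) \<Rightarrow> 'x set \<Rightarrow> nat \<Rightarrow> 'x set \<times> 'x set" where
  "greedy s A 0 = (A, A)"
| "greedy s A (Suc n) =
     (let (X, Y) = greedy s A n; P = X \<inter> T (s n) -` Y in (X - P, Y - T (s n) ` P))"

text \<open>A point that the greedy procedure never uses, neither as a source nor as a target, never returns
  along \<open>S\<close> to the set of such points, which is therefore null. Hence the domain of the limit
  injection has at least half the measure of \<open>A\<close>.\<close>

lemma matching_exists:
  assumes S: "S \<subseteq> \<Gamma>" and A: "A \<in> sets M" "0 < emeasure M A" "emeasure M A < \<infinity>"
    and rec: "\<And>B. \<lbrakk>B \<in> sets M; 0 < emeasure M B\<rbrakk> \<Longrightarrow> \<exists>\<gamma>\<in>S. 0 < emeasure M (B \<inter> T \<gamma> ` B)"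
  obtains k g P where "matching k g P A" "\<And>j. g j \<in> S"
proof -
  define s where "s = from_nat_into S"
  have "S \<noteq> {}" using rec[OF A(1,2)] by blast
  moreover have "countable S" using S countable_group countable_subset by blast
  ultimately have ran: "range s = S" unfolding s_def by (rule range_from_nat_into)
  then have sS: "s n \<in> S" for n by blast
  then have sG: "s n \<in> \<Gamma>" for n using S by blast
  define X where "X n = fst (greedy s A n)" for n
  define Y where "Y n = snd (greedy s A n)" for n
  define P where "P n = X n \<inter> T (s n) -` Y n" for n
  have X0: "X 0 = A" "Y 0 = A" by (simp_all add: X_def Y_def)
  have XS: "X (Suc n) = X n - P n" "Y (Suc n) = Y n - T (s n) ` P n" for n
    by (simp_all add: X_def Y_def P_def Let_def split: prod.split)
  have XY: "X n \<in> sets M \<and> Y n \<in> sets M" and P: "P n \<in> sets M" for n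
  proof -
    have Psets: "P n \<in> sets M" if "X n \<in> sets M" "Y n \<in> sets M" for n
    proof -
      have "P n = X n \<inter> (T (s n) -` Y n \<inter> space M)"
        using sets.sets_into_space[OF that(1)] by (auto simp: P_def)
      then show ?thesis using that T_vimage_sets[OF sG, of "Y n" n] by simp
    qed
    show XY: "X n \<in> sets M \<and> Y n \<in> sets M" for n
      by (induction n) (use A Psets T_image_sets[OF sG] in \<open>auto simp: X0 XS\<close>)
    show "P n \<in> sets M" by (rule Psets) (use XY in auto)
  qed
  have anti: "X n \<subseteq> X m" "Y n \<subseteq> Y m" if "m \<le> n" for m n
    using that by (auto elim!: lift_Suc_antimono_le[rotated, THEN subsetD] simp: XS)
  have PX: "P n \<subseteq> X n" "T (s n) ` P n \<subseteq> Y n" for n by (auto simp: P_def)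
  have sub: "P n \<subseteq> A" "T (s n) ` P n \<subseteq> A" for n
    using PX[of n] anti[of 0 n] by (auto simp: X0)
  have lt: "P m \<inter> P n = {}" "T (s m) ` P m \<inter> T (s n) ` P n = {}" if "m < n" for m n
  proof -
    have "P n \<subseteq> X m - P m" "T (s n) ` P n \<subseteq> Y m - T (s m) ` P m"
      using PX[of n] anti[of "Suc m" n] that XS[of m] by auto
    then show "P m \<inter> P n = {}" "T (s m) ` P m \<inter> T (s n) ` P n = {}" by blast+
  qed
  have disjP: "disjoint_family P" and disjT: "disjoint_family (\<lambda>n. T (s n) ` P n)"
    unfolding disjoint_family_on_def using lt by (metis Int_commute linorder_neqE_nat)+
  define B where "B = (\<Inter>n. X n) \<inter> (\<Inter>n. Y n)"
  have BM: "B \<in> sets M" unfolding B_def using XY by auto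
  have B0: "emeasure M B = 0"
  proof (rule ccontr)
    assume "emeasure M B \<noteq> 0"
    then obtain n where n: "0 < emeasure M (B \<inter> T (s n) ` B)"
      using rec[OF BM] ran by (auto simp: zero_less_iff_neq_zero)
    then have "B \<inter> T (s n) ` B \<noteq> {}" by (metis emeasure_empty less_irrefl)
    then obtain x where "x \<in> B" "T (s n) x \<in> B" by blast
    then have "x \<in> P n" "x \<in> X (Suc n)" unfolding B_def P_def by blast+
    then show False by (simp add: XS)
  qed
  define p where "p = emeasure M (\<Union>n. P n)"
  have TP: "T (s n) ` P n \<in> sets M" for n using T_image_sets[OF sG P] .
  have pT: "emeasure M (\<Union>n. T (s n) ` P n) = p"
  proof -
    have "emeasure M (\<Union>n. T (s n) ` P n) = (\<Sum>n. emeasure M (T (s n) ` P n))"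
      using disjT TP by (intro suminf_emeasure[symmetric]) auto
    also have "\<dots> = (\<Sum>n. emeasure M (P n))" by (simp add: emeasure_T_image sG P)
    also have "\<dots> = p" unfolding p_def using disjP P by (intro suminf_emeasure) auto
    finally show ?thesis .
  qed
  have cover: "A \<subseteq> B \<union> ((\<Union>n. P n) \<union> (\<Union>n. T (s n) ` P n))"
  proof
    fix x assume x: "x \<in> A"
    show "x \<in> B \<union> ((\<Union>n. P n) \<union> (\<Union>n. T (s n) ` P n))"
    proof (rule ccontr)
      assume n: "x \<notin> B \<union> ((\<Union>n. P n) \<union> (\<Union>n. T (s n) ` P n))"
      have "x \<in> X n \<and> x \<in> Y n" for n by (induction n) (use x n in \<open>auto simp: X0 XS\<close>)
      then show False using n by (simp add: B_def)
    qed
  qed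
  have "emeasure M A \<le> emeasure M (B \<union> ((\<Union>n. P n) \<union> (\<Union>n. T (s n) ` P n)))"
    using cover BM P TP by (intro emeasure_mono) auto
  also have "\<dots> \<le> emeasure M B + emeasure M ((\<Union>n. P n) \<union> (\<Union>n. T (s n) ` P n))"
    using BM P TP by (intro emeasure_subadditive) auto
  also have "\<dots> \<le> emeasure M B + (p + p)"
    using P TP pT by (intro add_left_mono order_trans[OF emeasure_subadditive]) (auto simp: p_def)
  finally have Ap: "emeasure M A \<le> p + p" by (simp add: B0)
  have pA: "p \<le> emeasure M A" unfolding p_def using sub(1) A(1) by (intro emeasure_mono) auto
  \<comment> \<open>Positivity and finiteness of \<open>p\<close> make \<open>2 * p < 3 * p\<close>
    strict in the extended reals.\<close>
  have "p \<noteq> 0" using Ap A(2) by auto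
  moreover have "p < top" using pA A(3) by (simp add: le_less_trans)
  ultimately have "p + p + 0 < p + p + p"
    by (intro ennreal_add_left_cancel_less[THEN iffD2]) (auto simp: zero_less_iff_neq_zero)
  also have "p + p + p = (1 + 1 + 1) * p" by (simp only: distrib_right mult_1)
  also have "\<dots> = 3 * p" by simp
  finally have A3: "emeasure M A < 3 * p" using Ap by simp
  \<comment> \<open>The gap between one half and one third is spent here: a finite part of the
    injection already satisfies the strict inequality.\<close>
  have "(\<lambda>k. 3 * emeasure M (\<Union>j<k. P j)) \<longlonglongrightarrow> 3 * p"
  proof (rule ennreal_tendsto_cmult)
    have "(\<lambda>k. emeasure M (\<Union>j<k. P j)) \<longlonglongrightarrow> emeasure M (\<Union>k. \<Union>j<k. P j)"
    proof (rule Lim_emeasure_incseq)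
      show "incseq (\<lambda>k. \<Union>j<k. P j)" unfolding incseq_def by (meson UN_mono lessThan_subset_iff order_refl)
    qed (use P in auto)
    moreover have "(\<Union>k. \<Union>j<k. P j) = (\<Union>n. P n)" by auto
    ultimately show "(\<lambda>k. emeasure M (\<Union>j<k. P j)) \<longlonglongrightarrow> p" by (simp only: p_def)
  qed simp
  then have "\<forall>\<^sub>F k in sequentially. emeasure M A < 3 * emeasure M (\<Union>j<k. P j)"
    using A3 by (rule order_tendstoD(1))
  then obtain k where k: "emeasure M A < 3 * emeasure M (\<Union>j<k. P j)" by (auto simp: eventually_sequentially)
  have "matching k s P A"
    unfolding matching_def using sG P sub k disjoint_family_on_mono[OF _ disjP] disjoint_family_on_mono[OF _ disjT]
    by auto
  then show ?thesis using that sS by blast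
qed

text \<open>Injectivity bounds the part of the matching that starts or ends in \<open>D - A\<close> by twice the measure
  of \<open>D - A\<close>; the rest stays in \<open>A\<close>.\<close>

lemma matching_returns:
  assumes m: "matching k g P D" and D: "D \<in> sets M" and A: "A \<in> sets M"
    and close: "7 * emeasure M (A - D \<union> (D - A)) < emeasure M A"
  shows "\<exists>j<k. 0 < emeasure M (A \<inter> T (g j) ` A)"
proof (rule ccontr)
  assume "\<not> (\<exists>j<k. 0 < emeasure M (A \<inter> T (g j) ` A))"
  then have null: "emeasure M (A \<inter> T (g j) ` A) = 0" if "j < k" for j
    using that by (simp add: zero_less_iff_neq_zero)
  have g: "g j \<in> \<Gamma>" and P: "P j \<in> sets M" "P j \<subseteq> D" "T (g j) ` P j \<subseteq> D" if "j < k" for j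
    using m that by (auto simp: matching_def)
  have disj: "disjoint_family_on P {..<k}" "disjoint_family_on (\<lambda>j. T (g j) ` P j) {..<k}"
    using m by (auto simp: matching_def)
  define s where "s = emeasure M (A - D \<union> (D - A))"
  have each: "emeasure M (P j) \<le> emeasure M (P j \<inter> (D - A)) + emeasure M (T (g j) ` P j \<inter> (D - A))"
    if j: "j < k" for j
  proof -
    define N where "N = P j \<inter> A \<inter> (T (g j) -` A \<inter> space M)"
    define Q where "Q = P j \<inter> (T (g j) -` (D - A) \<inter> space M)"
    have NQ: "N \<in> sets M" "Q \<in> sets M"
      unfolding N_def Q_def using P(1)[OF j] A D T_vimage_sets[OF g[OF j]] by auto
    have TPM: "T (g j) ` P j \<in> sets M" using T_image_sets[OF g[OF j] P(1)[OF j]] .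
    have "emeasure M N = emeasure M (T (g j) ` N)" using emeasure_T_image[OF g[OF j] NQ(1)] by simp
    also have "\<dots> \<le> emeasure M (A \<inter> T (g j) ` A)"
      using A T_image_sets[OF g[OF j] A] by (intro emeasure_mono) (auto simp: N_def)
    finally have N0: "emeasure M N = 0" using null[OF j] by simp
    have "emeasure M Q = emeasure M (T (g j) ` Q)" using emeasure_T_image[OF g[OF j] NQ(2)] by simp
    also have "\<dots> \<le> emeasure M (T (g j) ` P j \<inter> (D - A))"
      using A D TPM by (intro emeasure_mono) (auto simp: Q_def)
    finally have Q': "emeasure M Q \<le> emeasure M (T (g j) ` P j \<inter> (D - A))" .
    have "P j \<subseteq> N \<union> (P j \<inter> (D - A) \<union> Q)"
      using P(2,3)[OF j] sets.sets_into_space[OF P(1)[OF j]] by (auto simp: N_def Q_def)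
    then have "emeasure M (P j) \<le> emeasure M (N \<union> (P j \<inter> (D - A) \<union> Q))"
      using NQ P(1)[OF j] A D by (intro emeasure_mono) auto
    also have "\<dots> \<le> emeasure M N + emeasure M (P j \<inter> (D - A) \<union> Q)"
      using NQ P(1)[OF j] A D by (intro emeasure_subadditive) auto
    also have "\<dots> = emeasure M (P j \<inter> (D - A) \<union> Q)" by (simp add: N0)
    also have "\<dots> \<le> emeasure M (P j \<inter> (D - A)) + emeasure M Q"
      using NQ P(1)[OF j] A D by (intro emeasure_subadditive) auto
    finally show ?thesis using Q' by (meson add_left_mono order_trans)
  qed
  have pack: "(\<Sum>j<k. emeasure M (R j \<inter> (D - A))) \<le> s"
    if R: "\<And>j. j < k \<Longrightarrow> R j \<in> sets M" and dR: "disjoint_family_on R {..<k}" for R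
  proof -
    have "(\<Sum>j<k. emeasure M (R j \<inter> (D - A))) = emeasure M (\<Union>j<k. R j \<inter> (D - A))"
      using R dR A D by (intro sum_emeasure) (auto simp: disjoint_family_on_def)
    also have "\<dots> \<le> s" unfolding s_def using A D by (intro emeasure_mono) auto
    finally show ?thesis .
  qed
  have "emeasure M (\<Union>j<k. P j) = (\<Sum>j<k. emeasure M (P j))"
    using P disj by (intro sum_emeasure[symmetric]) auto
  also have "\<dots> \<le> (\<Sum>j<k. emeasure M (P j \<inter> (D - A)) + emeasure M (T (g j) ` P j \<inter> (D - A)))"
    using each by (intro sum_mono) auto
  also have "\<dots> \<le> s + s"
    unfolding sum.distrib using pack[of P] pack[of "\<lambda>j. T (g j) ` P j"] P disj T_image_sets g
    by (intro add_mono) auto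
  finally have 1: "emeasure M (\<Union>j<k. P j) \<le> s + s" .
  have "emeasure M A \<le> emeasure M (D \<union> (A - D \<union> (D - A)))" using A D by (intro emeasure_mono) auto
  also have "\<dots> \<le> emeasure M D + s" unfolding s_def using A D by (intro emeasure_subadditive) auto
  finally have 2: "emeasure M A \<le> emeasure M D + s" .
  have 3: "emeasure M D < 3 * emeasure M (\<Union>j<k. P j)" using m by (simp add: matching_def)
  show False using matching_arith[OF 2 3 1] close by (simp add: s_def)
qed

text \<open>Forward, the greedy construction is applied to \<open>D i\<close> itself. Backward, a
  subset \<open>B\<close> of \<open>A\<close> with finite measure \<open>b > 0\<close> is
  approximated within \<open>b / 8\<close>; as \<open>7 * (b / 8) < b\<close>,
  \<open>matching_returns\<close> carries a return from the matching of \<open>D i\<close> over to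
  \<open>B\<close>, hence to \<open>A\<close>.\<close>

lemma recurrent_iff_matching:
  assumes S: "S \<subseteq> \<Gamma>"
    and D: "\<And>n. D n \<in> sets M" "\<And>n. emeasure M (D n) < \<infinity>"
    and dense: "\<And>A e. \<lbrakk>A \<in> sets M; emeasure M A < \<infinity>; 0 < e\<rbrakk> \<Longrightarrow>
      \<exists>n. emeasure M (A - D n \<union> (D n - A)) < ennreal e"
  shows "(\<forall>A\<in>sets M. 0 < emeasure M A \<longrightarrow> (\<exists>\<gamma>\<in>S. 0 < emeasure M (A \<inter> T \<gamma> ` A))) \<longleftrightarrow>
    (\<forall>i. 0 < emeasure M (D i) \<longrightarrow> (\<exists>k g P. matching k g P (D i) \<and> (\<forall>j<k. g j \<in> S)))"
    (is "?L \<longleftrightarrow> ?R")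
proof
  assume L: ?L
  show ?R
  proof (intro allI impI)
    fix i assume i: "0 < emeasure M (D i)"
    obtain k g P where "matching k g P (D i)" "\<And>j. g j \<in> S"
      using matching_exists[OF S D(1) i D(2)] L by blast
    then show "\<exists>k g P. matching k g P (D i) \<and> (\<forall>j<k. g j \<in> S)" by blast
  qed
next
  assume R: ?R
  show ?L
  proof (intro ballI impI)
    fix A assume A: "A \<in> sets M" "0 < emeasure M A"
    \<comment> \<open>The dense family approximates only sets of finite measure, so a set of
      infinite measure is first shrunk.\<close>
    obtain B where B: "B \<in> sets M" "B \<subseteq> A" "0 < emeasure M B" "emeasure M B < \<infinity>"
    proof (cases "emeasure M A = \<infinity>")
      case True
      then obtain Z where "Z \<in> sets M" "Z \<subseteq> A" "emeasure M Z < \<infinity>" "ennreal 0 < emeasure M Z"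
        using approx_PInf_emeasure_with_finite[OF A(1), of 0] by blast
      then show ?thesis using that[of Z] by simp
    next
      case False
      then show ?thesis using that[of A] A by (auto simp: less_top)
    qed
    define b where "b = measure M B"
    have "emeasure M B \<noteq> top" using B(4) by auto
    then have b1: "emeasure M B = ennreal b" unfolding b_def by (rule emeasure_eq_ennreal_measure)
    then have b: "emeasure M B = ennreal b" "0 < b" using B(3) by auto
    obtain i where i: "emeasure M (B - D i \<union> (D i - B)) < ennreal (b / 8)"
      using dense[OF B(1,4), of "b / 8"] b by auto
    have "7 * emeasure M (B - D i \<union> (D i - B)) \<le> 7 * ennreal (b / 8)"
      using i by (intro mult_left_mono) auto
    also have "\<dots> = ennreal (7 * (b / 8))" using b by (subst ennreal_mult) auto
    also have "\<dots> < ennreal b" using b by (intro ennreal_lessI) auto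
    finally have close: "7 * emeasure M (B - D i \<union> (D i - B)) < emeasure M B" by (simp add: b)
    have "0 < emeasure M (D i)"
    proof (rule ccontr)
      assume "\<not> 0 < emeasure M (D i)"
      then have D0: "emeasure M (D i) = 0" by (simp add: zero_less_iff_neq_zero)
      have "emeasure M B \<le> emeasure M (D i \<union> (B - D i \<union> (D i - B)))"
        using B(1) D(1)[of i] by (intro emeasure_mono) auto
      also have "\<dots> \<le> emeasure M (D i) + emeasure M (B - D i \<union> (D i - B))"
        using B(1) D(1)[of i] by (intro emeasure_subadditive) auto
      also have "\<dots> < ennreal (b / 8)" using i D0 by simp
      also have "\<dots> \<le> ennreal b" using b by (intro ennreal_leI) simp
      finally show False by (simp add: b)
    qed
    then obtain k g P where m: "matching k g P (D i)" "\<And>j. j < k \<Longrightarrow> g j \<in> S" using R by blast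
    obtain j where j: "j < k" "0 < emeasure M (B \<inter> T (g j) ` B)"
      using matching_returns[OF m(1) D(1) B(1) close] by blast
    have "emeasure M (B \<inter> T (g j) ` B) \<le> emeasure M (A \<inter> T (g j) ` A)"
      using B A T_image_sets m(2)[OF j(1)] S by (intro emeasure_mono) auto
    then show "\<exists>\<gamma>\<in>S. 0 < emeasure M (A \<inter> T \<gamma> ` A)" using j m(2) by (meson less_le_trans)
  qed
qed

text \<open>A diagonal argument: stage \<open>n\<close> asks for one element that serves the first
  \<open>n\<close> dense sets at precision 1/(n+1) and avoids the first \<open>n\<close> terms of an
  enumeration of \<Gamma>, which forces escape to infinity. The function \<open>h\<close> stands for
  the distance to the one-parameter subgroup. For finite \<Gamma> both sides are false.\<close>

lemma rigid_iff_dense: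
  fixes h :: "'g \<Rightarrow> real"
  assumes h: "\<And>\<gamma>. 0 \<le> h \<gamma>"
    and D: "\<And>n. D n \<in> sets M" "\<And>n. emeasure M (D n) < \<infinity>"
    and dense: "\<And>A e. \<lbrakk>A \<in> sets M; emeasure M A < \<infinity>; 0 < e\<rbrakk> \<Longrightarrow>
      \<exists>n. emeasure M (A - D n \<union> (D n - A)) < ennreal e"
  shows "(\<exists>\<gamma>. (\<forall>n. \<gamma> n \<in> \<Gamma>) \<and> filterlim \<gamma> cofinite sequentially \<and> (\<lambda>n. h (\<gamma> n)) \<longlonglongrightarrow> 0 \<and>
      (\<forall>A\<in>sets M. emeasure M A < \<infinity> \<longrightarrow> (\<lambda>n. emeasure M (A \<inter> T (\<gamma> n) ` A)) \<longlonglongrightarrow> emeasure M A)) \<longleftrightarrow>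
    (\<forall>n. \<exists>\<gamma>\<in>\<Gamma>. \<gamma> \<notin> from_nat_into \<Gamma> ` {..<n} \<and> h \<gamma> < 1 / real (Suc n) \<and>
      (\<forall>i<n. emeasure M (D i - T \<gamma> ` D i) < ennreal (1 / real (Suc n))))"
    (is "?L \<longleftrightarrow> ?R")
proof
  assume ?L
  then obtain \<gamma> where \<gamma>: "\<And>n. \<gamma> n \<in> \<Gamma>" "filterlim \<gamma> cofinite sequentially" "(\<lambda>n. h (\<gamma> n)) \<longlonglongrightarrow> 0"
    "\<And>A. \<lbrakk>A \<in> sets M; emeasure M A < \<infinity>\<rbrakk> \<Longrightarrow> (\<lambda>n. emeasure M (A \<inter> T (\<gamma> n) ` A)) \<longlonglongrightarrow> emeasure M A"
    by blast
  show ?R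
  proof
    fix n
    have "\<forall>\<^sub>F x in cofinite. x \<notin> from_nat_into \<Gamma> ` {..<n}" by (simp add: eventually_cofinite)
    then have "\<forall>\<^sub>F k in sequentially. \<gamma> k \<notin> from_nat_into \<Gamma> ` {..<n}"
      using \<gamma>(2) unfolding filterlim_iff by blast
    moreover have "\<forall>\<^sub>F k in sequentially. h (\<gamma> k) < 1 / real (Suc n)"
      using \<gamma>(3) by (rule order_tendstoD(2)) simp
    moreover have "\<forall>\<^sub>F k in sequentially. \<forall>i\<in>{..<n}. emeasure M (D i - T (\<gamma> k) ` D i) < ennreal (1 / real (Suc n))"
    proof (intro eventually_ball_finite ballI)
      fix i
      have "(\<lambda>k. emeasure M (D i - T (\<gamma> k) ` D i)) \<longlonglongrightarrow> 0"
        using \<gamma>(4)[OF D, of i] tendsto_intersection_iff[of \<gamma> "D i" sequentially, OF \<gamma>(1) D] by blast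
      then show "\<forall>\<^sub>F k in sequentially. emeasure M (D i - T (\<gamma> k) ` D i) < ennreal (1 / real (Suc n))"
        by (rule order_tendstoD(2)) simp
    qed simp
    ultimately have "\<forall>\<^sub>F k in sequentially. \<gamma> k \<notin> from_nat_into \<Gamma> ` {..<n} \<and> h (\<gamma> k) < 1 / real (Suc n) \<and>
        (\<forall>i\<in>{..<n}. emeasure M (D i - T (\<gamma> k) ` D i) < ennreal (1 / real (Suc n)))"
      by eventually_elim blast
    then obtain k where "\<gamma> k \<notin> from_nat_into \<Gamma> ` {..<n}" "h (\<gamma> k) < 1 / real (Suc n)"
        "\<forall>i\<in>{..<n}. emeasure M (D i - T (\<gamma> k) ` D i) < ennreal (1 / real (Suc n))"
      by (auto simp: eventually_sequentially)
    then show "\<exists>\<gamma>\<in>\<Gamma>. \<gamma> \<notin> from_nat_into \<Gamma> ` {..<n} \<and> h \<gamma> < 1 / real (Suc n) \<and>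
      (\<forall>i<n. emeasure M (D i - T \<gamma> ` D i) < ennreal (1 / real (Suc n)))"
      using \<gamma>(1)[of k] by (intro bexI[of _ "\<gamma> k"]) auto
  qed
next
  assume ?R
  then obtain \<gamma> where \<gamma>: "\<And>n. \<gamma> n \<in> \<Gamma>" "\<And>n. \<gamma> n \<notin> from_nat_into \<Gamma> ` {..<n}"
    "\<And>n. h (\<gamma> n) < 1 / real (Suc n)"
    "\<And>n i. i < n \<Longrightarrow> emeasure M (D i - T (\<gamma> n) ` D i) < ennreal (1 / real (Suc n))"
    by metis
  have "filterlim \<gamma> cofinite sequentially"
    unfolding filterlim_iff
  proof (intro allI impI)
    fix Q :: "'g \<Rightarrow> bool" assume "eventually Q cofinite"
    then have fin: "finite {x. \<not> Q x}" by (simp add: eventually_cofinite)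
    have "\<forall>\<^sub>F n in sequentially. \<forall>x\<in>{x. \<not> Q x}. \<gamma> n \<noteq> x"
    proof (intro eventually_ball_finite fin ballI)
      fix x
      show "\<forall>\<^sub>F n in sequentially. \<gamma> n \<noteq> x"
      proof (cases "x \<in> \<Gamma>")
        case True
        then obtain j where "x = from_nat_into \<Gamma> j" using from_nat_into_surj[OF countable_group] by metis
        then have "\<gamma> n \<noteq> x" if "n \<ge> Suc j" for n using \<gamma>(2)[of n] that by auto
        then show ?thesis by (auto simp: eventually_sequentially)
      next
        case False
        then show ?thesis using \<gamma>(1) by (metis (mono_tags, lifting) always_eventually)
      qed
    qed
    then show "\<forall>\<^sub>F n in sequentially. Q (\<gamma> n)" by eventually_elim blast
  qed
  moreover have "(\<lambda>n. h (\<gamma> n)) \<longlonglongrightarrow> 0"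
    by (rule tendsto_sandwich[OF _ _ tendsto_const LIMSEQ_Suc[OF lim_1_over_n]])
      (use h \<gamma>(3) in \<open>auto intro!: always_eventually less_imp_le\<close>)
  moreover have "(\<lambda>n. emeasure M (A \<inter> T (\<gamma> n) ` A)) \<longlonglongrightarrow> emeasure M A"
    if A: "A \<in> sets M" "emeasure M A < \<infinity>" for A
    unfolding tendsto_intersection_iff[OF \<gamma>(1) A]
  proof (rule order_tendstoI)
    fix a :: ennreal assume "0 < a"
    then obtain e where e: "0 < e" "ennreal e \<le> a"
      by (cases a rule: ennreal_cases) (auto intro: that[of 1] that)
    obtain i where i: "emeasure M (A - D i \<union> (D i - A)) < ennreal (e / 2)" using dense[OF A, of "e / 2"] e by auto
    obtain N where N: "1 / real (Suc N) < e / 2" using nat_approx_posE[of "e / 2"] e by auto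
    \<comment> \<open>\<open>n > i\<close> puts \<open>D i\<close> among the sets controlled at
      stage \<open>n\<close>, and \<open>n > N\<close> makes the precision there finer than
      \<open>e / 2\<close>.\<close>
    have "emeasure M (A - T (\<gamma> n) ` A) < a" if n: "n \<ge> Suc (max i N)" for n
    proof -
      have "emeasure M (D i - T (\<gamma> n) ` D i) < ennreal (1 / real (Suc n))" using \<gamma>(4)[of i n] n by simp
      also have "\<dots> \<le> ennreal (1 / real (Suc N))" using n by (intro ennreal_leI divide_left_mono) auto
      also have "\<dots> \<le> ennreal (e / 2)" using N by (intro ennreal_leI) simp
      finally have "emeasure M (D i - T (\<gamma> n) ` D i) < ennreal (e / 2)" .
      then have "emeasure M (D i - T (\<gamma> n) ` D i) + emeasure M (A - D i \<union> (D i - A)) < ennreal (e / 2) + ennreal (e / 2)"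
        using i by (rule add_strict_mono)
      also have "\<dots> = ennreal e" using e by (simp flip: ennreal_plus)
      finally show ?thesis using defect_perturbation[OF \<gamma>(1) A(1) D(1), of n i] e(2) by (meson le_less_trans less_le_trans)
    qed
    then show "\<forall>\<^sub>F n in sequentially. emeasure M (A - T (\<gamma> n) ` A) < a" by (auto simp: eventually_sequentially)
  qed simp
  ultimately show ?L using \<gamma>(1) by blast
qed

end

theorem theorem2p6:
  fixes \<A> :: "('g::{metric_space, second_countable_topology, topological_group_add},
                'e::euclidean_space) chart set"
    and U :: "'g set" and \<phi> :: "'g \<Rightarrow> 'e"
    and \<Gamma> :: "'g set"
    and M :: "'x measure" and T :: "'g \<Rightarrow> 'x \<Rightarrow> 'x"
  assumes "lie_group \<A>"
    and "simply_connected (UNIV :: 'g set)"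
    and "nilpotent_group TYPE('g)"
    and "\<And>x y z :: 'g. dist (x + z) (y + z) = dist x y"
    and "(U, \<phi>) \<in> \<A>" and "0 \<in> U"
    and "lattice_subgroup \<Gamma>"
    and "sigma_finite_measure M" and "standard_measure_space M"
    and "measure_preserving_action \<Gamma> M T"
  shows "gdelta_in projective_space (recurrent_directions \<phi> \<Gamma> M T) \<and>
         gdelta_in projective_space (rigid_directions \<phi> \<Gamma> M T)"
proof -
  interpret sigma_finite_measure M by fact
  interpret countable_group_action M \<Gamma> T
    by unfold_locales (use assms countable_discrete in \<open>auto simp: lattice_subgroup_def\<close>)
  obtain D :: "nat \<Rightarrow> 'x set" where D: "\<And>n. D n \<in> sets M" "\<And>n. emeasure M (D n) < \<infinity>"
    and dense: "\<And>A e. \<lbrakk>A \<in> sets M; emeasure M A < \<infinity>; 0 < e\<rbrakk> \<Longrightarrow>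
      \<exists>n. emeasure M (A - D n \<union> (D n - A)) < ennreal e"
    using standard_measure_space_generator[OF assms(9)] countable_dense_sets by metis
  define near where "near \<gamma> \<epsilon> \<theta> \<longleftrightarrow> (\<exists>g\<in>lie_exp \<phi> ` \<theta>. dist \<gamma> g < \<epsilon>)" for \<gamma> \<epsilon> \<theta>
  have open_near: "openin projective_space {\<theta> \<in> lines. near \<gamma> \<epsilon> \<theta>}" for \<gamma> \<epsilon>
    using openin_projective_space_hitting[OF continuous_on_lie_exp[OF assms(1,5,6)] open_ball[of \<gamma> \<epsilon>]]
    by (simp add: near_def)
  have near_mono: "near \<gamma> \<epsilon>' \<theta>" if "near \<gamma> \<epsilon> \<theta>" "\<epsilon> \<le> \<epsilon>'" for \<gamma> \<epsilon> \<epsilon>' \<theta>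
    using that by (force simp: near_def)
  \<comment> \<open>Used with index type \<open>nat \<times> nat\<close> for recurrence and
    \<open>nat\<close> for rigidity.\<close>
  have gdelta: "gdelta_in projective_space {\<theta> \<in> lines. \<forall>i. Q i \<theta>}"
    if "\<And>i. openin projective_space {\<theta> \<in> lines. Q i \<theta>}" for Q :: "'i::countable \<Rightarrow> 'e set \<Rightarrow> bool"
  proof -
    have "gdelta_in projective_space (\<Inter>(range (\<lambda>i. {\<theta> \<in> lines. Q i \<theta>})))"
      by (rule gdelta_in_Inter) (use that open_imp_gdelta_in in auto)
    moreover have "\<Inter>(range (\<lambda>i. {\<theta> \<in> lines. Q i \<theta>})) = {\<theta> \<in> lines. \<forall>i. Q i \<theta>}" by auto
    ultimately show ?thesis by simp
  qed
  have "gdelta_in projective_space (recurrent_directions \<phi> \<Gamma> M T)"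
  proof -
    \<comment> \<open>Fixing the precision turns recurrence along \<theta> into returns along a
      fixed subset of \<Gamma>, as \<open>recurrent_iff_matching\<close> requires.\<close>
    define S where "S n \<theta> = {\<gamma> \<in> \<Gamma> - {0}. near \<gamma> (1 / real (Suc n)) \<theta>}" for n \<theta>
    define Q where "Q = (\<lambda>(n, i) \<theta>. 0 < emeasure M (D i) \<longrightarrow>
      (\<exists>k g P. matching k g P (D i) \<and> (\<forall>j<k. g j \<in> S n \<theta>)))"
    have rec: "recurrent_along \<phi> \<Gamma> M T \<theta> \<longleftrightarrow>
        (\<forall>n. \<forall>A\<in>sets M. 0 < emeasure M A \<longrightarrow> (\<exists>\<gamma>\<in>S n \<theta>. 0 < emeasure M (A \<inter> T \<gamma> ` A)))" (is "_ \<longleftrightarrow> ?R") for \<theta>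
    proof
      assume L: "recurrent_along \<phi> \<Gamma> M T \<theta>"
      show ?R
      proof (intro allI ballI impI)
        fix n A assume "A \<in> sets M" "0 < emeasure M A"
        moreover have "0 < 1 / real (Suc n)" by simp
        ultimately obtain \<gamma> g where "\<gamma> \<in> \<Gamma> - {0}" "g \<in> lie_exp \<phi> ` \<theta>" "dist \<gamma> g < 1 / real (Suc n)"
          "0 < emeasure M (A \<inter> T \<gamma> ` A)"
          using L unfolding recurrent_along_def by blast
        then show "\<exists>\<gamma>\<in>S n \<theta>. 0 < emeasure M (A \<inter> T \<gamma> ` A)" unfolding S_def near_def by blast
      qed
    next
      assume R: ?R
      show "recurrent_along \<phi> \<Gamma> M T \<theta>"
        unfolding recurrent_along_def
      proof (intro allI impI ballI)
        fix \<epsilon> :: real and A assume "0 < \<epsilon>" "A \<in> sets M" "0 < emeasure M A"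
        then obtain n where n: "1 / real (Suc n) < \<epsilon>" using nat_approx_posE by blast
        obtain \<gamma> where "\<gamma> \<in> S n \<theta>" "0 < emeasure M (A \<inter> T \<gamma> ` A)"
          using R \<open>A \<in> sets M\<close> \<open>0 < emeasure M A\<close> by blast
        moreover from this have "near \<gamma> \<epsilon> \<theta>" using n by (intro near_mono[of \<gamma> _ \<theta> \<epsilon>]) (auto simp: S_def)
        ultimately show "\<exists>\<gamma>\<in>\<Gamma> - {0}. \<exists>g\<in>lie_exp \<phi> ` \<theta>. dist \<gamma> g < \<epsilon> \<and> 0 < emeasure M (A \<inter> T \<gamma> ` A)"
          unfolding S_def near_def by blast
      qed
    qed
    have "recurrent_along \<phi> \<Gamma> M T \<theta> \<longleftrightarrow> (\<forall>p. Q p \<theta>)" for \<theta>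
    proof -
      have "S n \<theta> \<subseteq> \<Gamma>" for n by (auto simp: S_def)
      from recurrent_iff_matching[OF this D dense] show ?thesis
        unfolding rec Q_def split_paired_All prod.case by blast
    qed
    then have eq: "recurrent_directions \<phi> \<Gamma> M T = {\<theta> \<in> lines. \<forall>p. Q p \<theta>}"
      unfolding recurrent_directions_def by blast
    show ?thesis unfolding eq
    proof (rule gdelta)
      fix p :: "nat \<times> nat"
      obtain n i where p: "p = (n, i)" by (cases p)
      \<comment> \<open>The part of the condition that does not involve \<theta>: which finite
        tuples of nonzero elements admit a matching. It may be an arbitrary index set, since unions
        of open sets are open.\<close>
      define Z where "Z = {(k, g). (\<exists>P. matching k g P (D i)) \<and> (\<forall>j<k. g j \<noteq> 0)}"
      have mem: "g j \<in> \<Gamma>" if "matching k g P (D i)" "j < k" for k g P j using that by (simp add: matching_def)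
      show "openin projective_space {\<theta> \<in> lines. Q p \<theta>}"
      proof (cases "0 < emeasure M (D i)")
        case True
        \<comment> \<open>The explicit \<open>topspace\<close> takes care of the empty intersection
          at \<open>k = 0\<close>.\<close>
        have "{\<theta> \<in> lines. Q p \<theta>} = (\<Union>(k, g)\<in>Z. (\<Inter>j\<in>{..<k}. {\<theta> \<in> lines. near (g j) (1 / real (Suc n)) \<theta>}) \<inter> topspace projective_space)"
          using True mem by (auto simp: Q_def p S_def Z_def topspace_projective_space) blast+
        also have "openin projective_space \<dots>"
          using open_near by (intro openin_Union) (auto intro!: openin_INT)
        finally show ?thesis .
      next
        case False
        then have "{\<theta> \<in> lines. Q p \<theta>} = topspace projective_space"
          by (auto simp: Q_def p topspace_projective_space)
        then show ?thesis by simp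
      qed
    qed
  qed
  moreover have "gdelta_in projective_space (rigid_directions \<phi> \<Gamma> M T)"
  proof -
    define Z where "Z n = {\<gamma> \<in> \<Gamma>. \<gamma> \<notin> from_nat_into \<Gamma> ` {..<n} \<and>
      (\<forall>i<n. emeasure M (D i - T \<gamma> ` D i) < ennreal (1 / real (Suc n)))}" for n
    have "rigid_along \<phi> \<Gamma> M T \<theta> \<longleftrightarrow> (\<forall>n. \<exists>\<gamma>\<in>Z n. near \<gamma> (1 / real (Suc n)) \<theta>)" if \<theta>: "\<theta> \<in> lines" for \<theta>
    proof -
      define h where "h \<gamma> = (INF g\<in>lie_exp \<phi> ` \<theta>. dist \<gamma> g)" for \<gamma>
      have ne: "\<theta> \<noteq> {}" using \<theta> subspace_0 by (auto simp: lines_def)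
      have h: "0 \<le> h \<gamma>" for \<gamma> unfolding h_def using ne by (intro cINF_greatest) auto
      \<comment> \<open>An infimum lies strictly below \<epsilon> exactly when some value does, so
        the bound on \<open>h\<close> becomes an open condition on \<theta>.\<close>
      have less: "h \<gamma> < \<epsilon> \<longleftrightarrow> near \<gamma> \<epsilon> \<theta>" for \<gamma> \<epsilon>
        unfolding h_def near_def using ne by (subst cINF_less_iff) (auto intro!: bdd_belowI2[of _ 0])
      show ?thesis
        using rigid_iff_dense[where h = h and D = D, OF h D dense]
        unfolding rigid_along_def h_def[symmetric] less Z_def by blast
    qed
    then have eq: "rigid_directions \<phi> \<Gamma> M T = {\<theta> \<in> lines. \<forall>n. \<exists>\<gamma>\<in>Z n. near \<gamma> (1 / real (Suc n)) \<theta>}"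
      unfolding rigid_directions_def by blast
    show ?thesis unfolding eq
    proof (rule gdelta)
      fix n
      have "{\<theta> \<in> lines. \<exists>\<gamma>\<in>Z n. near \<gamma> (1 / real (Suc n)) \<theta>} = (\<Union>\<gamma>\<in>Z n. {\<theta> \<in> lines. near \<gamma> (1 / real (Suc n)) \<theta>})"
        by blast
      then show "openin projective_space {\<theta> \<in> lines. \<exists>\<gamma>\<in>Z n. near \<gamma> (1 / real (Suc n)) \<theta>}"
        using open_near by auto
    qed
  qed
  ultimately show ?thesis ..
qed

end
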